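(* Let $\Bbbk$ be a field of characteristic zero and let $A$ be an affine Poisson domain over $\Bbbk$ with finite Krull dimension. If $A$ has no nontrivial locally nilpotent Poisson derivations, then $A$ is Poisson cancellative.
   Context: A Poisson algebra over $\Bbbk$ is a commutative $\Bbbk$-algebra $A$ with a $\Bbbk$-bilinear bracket $\{\,,\}$ making $A$ a Lie algebra and such that $\{a,-\}$ is a $\Bbbk$-derivation of $A$ for every $a\in A$. An affine Poisson domain is a Poisson algebra that is a finitely generated $\Bbbk$-algebra and an integral domain. A Poisson derivation is a $\Bbbk$-derivation $\alpha$ of $A$ with $\alpha(\{a,b\})=\{\alpha(a),b\}+\{a,\alpha(b)\}$ for all $a,b\in A$; it is locally nilpotent if for each $a\in A$ there is $n$ with $\alpha^n(a)=0$; nontrivial means nonzero. The polynomial algebra $A[t]$ carries the Poisson bracket extending that of $A$ with $\{t,a\}=0$ for all $a\in A$. $A$ is Poisson cancellative if for every Poisson algebra $B$ over $\Bbbk$, an isomorphism of Poisson algebras $A[t]\cong B[t]$ implies $A\cong B$ as Poisson algebras. *)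

theory Defs
  imports "HOL-Algebra.UnivPoly" "HOL-Algebra.QuotRing" "HOL-Algebra.Generated_Rings"
    "HOL-Library.Extended_Nat"
begin

record ('k, 'a) poisson_ring = "('k, 'a) module" +
  bracket :: "'a \<Rightarrow> 'a \<Rightarrow> 'a" (\<open>\<lbrace>_,_\<rbrace>\<index>\<close>)

definition derivation ::
  "('k, 'l) ring_scheme \<Rightarrow> ('k, 'a, 'm) module_scheme \<Rightarrow> ('a \<Rightarrow> 'a) \<Rightarrow> bool" where
  "derivation K A d \<longleftrightarrow>
     d \<in> carrier A \<rightarrow> carrier A \<and>
     (\<forall>x\<in>carrier A. \<forall>y\<in>carrier A. d (x \<oplus>\<^bsub>A\<^esub> y) = d x \<oplus>\<^bsub>A\<^esub> d y) \<and>
     (\<forall>c\<in>carrier K. \<forall>x\<in>carrier A. d (c \<odot>\<^bsub>A\<^esub> x) = c \<odot>\<^bsub>A\<^esub> d x) \<and>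
     (\<forall>x\<in>carrier A. \<forall>y\<in>carrier A. d (x \<otimes>\<^bsub>A\<^esub> y) = d x \<otimes>\<^bsub>A\<^esub> y \<oplus>\<^bsub>A\<^esub> x \<otimes>\<^bsub>A\<^esub> d y)"

text \<open>Linearity of the bracket in the second argument is part of \<open>bracket_derivation\<close>.\<close>

locale poisson_algebra = algebra K A
  for K (structure) and A :: "('k, 'a, 'm) poisson_ring_scheme" (structure) +
  assumes bracket_add_left:
      "\<lbrakk>x \<in> carrier A; y \<in> carrier A; z \<in> carrier A\<rbrakk>
       \<Longrightarrow> \<lbrace>x \<oplus>\<^bsub>A\<^esub> y, z\<rbrace>\<^bsub>A\<^esub> = \<lbrace>x, z\<rbrace>\<^bsub>A\<^esub> \<oplus>\<^bsub>A\<^esub> \<lbrace>y, z\<rbrace>\<^bsub>A\<^esub>"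
    and bracket_smult_left:
      "\<lbrakk>c \<in> carrier K; x \<in> carrier A; y \<in> carrier A\<rbrakk>
       \<Longrightarrow> \<lbrace>c \<odot>\<^bsub>A\<^esub> x, y\<rbrace>\<^bsub>A\<^esub> = c \<odot>\<^bsub>A\<^esub> \<lbrace>x, y\<rbrace>\<^bsub>A\<^esub>"
    and bracket_self: "x \<in> carrier A \<Longrightarrow> \<lbrace>x, x\<rbrace>\<^bsub>A\<^esub> = \<zero>\<^bsub>A\<^esub>"
    and bracket_jacobi:
      "\<lbrakk>x \<in> carrier A; y \<in> carrier A; z \<in> carrier A\<rbrakk>
       \<Longrightarrow> \<lbrace>x, \<lbrace>y, z\<rbrace>\<^bsub>A\<^esub>\<rbrace>\<^bsub>A\<^esub> \<oplus>\<^bsub>A\<^esub> \<lbrace>y, \<lbrace>z, x\<rbrace>\<^bsub>A\<^esub>\<rbrace>\<^bsub>A\<^esub> \<oplus>\<^bsub>A\<^esub> \<lbrace>z, \<lbrace>x, y\<rbrace>\<^bsub>A\<^esub>\<rbrace>\<^bsub>A\<^esub> = \<zero>\<^bsub>A\<^esub>"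
    and bracket_derivation: "x \<in> carrier A \<Longrightarrow> derivation K A (\<lambda>y. \<lbrace>x, y\<rbrace>\<^bsub>A\<^esub>)"

definition poisson_iso ::
  "('k, 'l) ring_scheme \<Rightarrow> ('k, 'a, 'm) poisson_ring_scheme \<Rightarrow> ('k, 'b, 'n) poisson_ring_scheme
     \<Rightarrow> ('a \<Rightarrow> 'b) set" where
  "poisson_iso K A B = {h \<in> ring_iso A B.
     (\<forall>c\<in>carrier K. \<forall>x\<in>carrier A. h (c \<odot>\<^bsub>A\<^esub> x) = c \<odot>\<^bsub>B\<^esub> h x) \<and>
     (\<forall>x\<in>carrier A. \<forall>y\<in>carrier A. h \<lbrace>x, y\<rbrace>\<^bsub>A\<^esub> = \<lbrace>h x, h y\<rbrace>\<^bsub>B\<^esub>)}"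

definition poisson_isomorphic ::
  "('k, 'l) ring_scheme \<Rightarrow> ('k, 'a, 'm) poisson_ring_scheme \<Rightarrow> ('k, 'b, 'n) poisson_ring_scheme
     \<Rightarrow> bool" where
  "poisson_isomorphic K A B \<longleftrightarrow> poisson_iso K A B \<noteq> {}"

text \<open>
  The Poisson algebra \<open>A[t]\<close>: its ring structure is that of \<^const>\<open>UP\<close>, whose elements are the
  coefficient sequences.  Since \<open>{t, a} = 0\<close> for \<open>a\<close> in \<open>A\<close> and \<open>{t, t} = 0\<close>, the Leibniz rule
  forces \<open>{a t^i, b t^j} = {a, b} t^(i + j)\<close>; the bracket below is the biadditive extension of
  this (see \<open>poly_bracket_monom\<close> and \<open>poisson_poly_algebra\<close>).
\<close>

definition poisson_poly ::
  "('k, 'a, 'm) poisson_ring_scheme \<Rightarrow> ('k, nat \<Rightarrow> 'a) poisson_ring" where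
  "poisson_poly A = \<lparr>
     carrier = carrier (UP A),
     monoid.mult = monoid.mult (UP A),
     one = \<one>\<^bsub>UP A\<^esub>,
     zero = \<zero>\<^bsub>UP A\<^esub>,
     add = add (UP A),
     smult = (\<lambda>c p n. c \<odot>\<^bsub>A\<^esub> p n),
     bracket = (\<lambda>p q n. \<Oplus>\<^bsub>A\<^esub>i\<in>{..n}. \<lbrace>p i, q (n - i)\<rbrace>\<^bsub>A\<^esub>)\<rparr>"

definition char_zero :: "('k, 'l) ring_scheme \<Rightarrow> bool" where
  "char_zero K \<longleftrightarrow> (\<forall>n::nat. n > 0 \<longrightarrow> [n] \<cdot>\<^bsub>K\<^esub> \<one>\<^bsub>K\<^esub> \<noteq> \<zero>\<^bsub>K\<^esub>)"

definition finitely_generated_algebra ::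
  "('k, 'l) ring_scheme \<Rightarrow> ('k, 'a, 'm) module_scheme \<Rightarrow> bool" where
  "finitely_generated_algebra K A \<longleftrightarrow>
     (\<exists>S. finite S \<and> S \<subseteq> carrier A \<and>
        carrier A = generate_ring A ((\<lambda>c. c \<odot>\<^bsub>A\<^esub> \<one>\<^bsub>A\<^esub>) ` carrier K \<union> S))"

definition affine_poisson_domain ::
  "('k, 'l) ring_scheme \<Rightarrow> ('k, 'a, 'm) poisson_ring_scheme \<Rightarrow> bool" where
  "affine_poisson_domain K A \<longleftrightarrow>
     poisson_algebra K A \<and> finitely_generated_algebra K A \<and> domain A"

definition krull_dim :: "('a, 'm) ring_scheme \<Rightarrow> enat" where
  "krull_dim R = Sup {enat n | n. \<exists>P :: nat \<Rightarrow> 'a set.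
     (\<forall>i\<le>n. primeideal (P i) R) \<and> (\<forall>i<n. P i \<subset> P (Suc i))}"

definition poisson_derivation ::
  "('k, 'l) ring_scheme \<Rightarrow> ('k, 'a, 'm) poisson_ring_scheme \<Rightarrow> ('a \<Rightarrow> 'a) \<Rightarrow> bool" where
  "poisson_derivation K A d \<longleftrightarrow> derivation K A d \<and>
     (\<forall>x\<in>carrier A. \<forall>y\<in>carrier A. d \<lbrace>x, y\<rbrace>\<^bsub>A\<^esub> = \<lbrace>d x, y\<rbrace>\<^bsub>A\<^esub> \<oplus>\<^bsub>A\<^esub> \<lbrace>x, d y\<rbrace>\<^bsub>A\<^esub>)"

definition locally_nilpotent :: "('a, 'm) ring_scheme \<Rightarrow> ('a \<Rightarrow> 'a) \<Rightarrow> bool" where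
  "locally_nilpotent A d \<longleftrightarrow> (\<forall>x\<in>carrier A. \<exists>n. (d ^^ n) x = \<zero>\<^bsub>A\<^esub>)"

definition nontrivial_map :: "('a, 'm) ring_scheme \<Rightarrow> ('a \<Rightarrow> 'a) \<Rightarrow> bool" where
  "nontrivial_map A d \<longleftrightarrow> (\<exists>x\<in>carrier A. d x \<noteq> \<zero>\<^bsub>A\<^esub>)"

text \<open>
  HOL cannot quantify over types inside a formula, so the type that holds the carrier of \<open>B\<close> is a
  parameter; a theorem concluding this for a type variable \<open>'b\<close> covers every Poisson algebra \<open>B\<close>.
\<close>

definition poisson_cancellative ::
  "'b itself \<Rightarrow> ('k, 'l) ring_scheme \<Rightarrow> ('k, 'a, 'm) poisson_ring_scheme \<Rightarrow> bool" where
  "poisson_cancellative _ K A \<longleftrightarrow>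
     (\<forall>B :: ('k, 'b) poisson_ring. poisson_algebra K B \<longrightarrow>
        poisson_isomorphic K (poisson_poly A) (poisson_poly B) \<longrightarrow> poisson_isomorphic K A B)"

lemma poisson_poly_sel:
  "carrier (poisson_poly A) = carrier (UP A)"
  "monoid.mult (poisson_poly A) = monoid.mult (UP A)"
  "\<one>\<^bsub>poisson_poly A\<^esub> = \<one>\<^bsub>UP A\<^esub>"
  "\<zero>\<^bsub>poisson_poly A\<^esub> = \<zero>\<^bsub>UP A\<^esub>"
  "add (poisson_poly A) = add (UP A)"
  "smult (poisson_poly A) = (\<lambda>c p n. c \<odot>\<^bsub>A\<^esub> p n)"
  "bracket (poisson_poly A) = (\<lambda>p q n. \<Oplus>\<^bsub>A\<^esub>i\<in>{..n}. \<lbrace>p i, q (n - i)\<rbrace>\<^bsub>A\<^esub>)"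
  by (simp_all add: poisson_poly_def)

context poisson_algebra
begin

lemma bracket_closed:
  "x \<in> carrier A \<Longrightarrow> y \<in> carrier A \<Longrightarrow> \<lbrace>x, y\<rbrace>\<^bsub>A\<^esub> \<in> carrier A"
  using bracket_derivation[of x] by (auto simp: derivation_def)

lemma bracket_add_right:
  "x \<in> carrier A \<Longrightarrow> y \<in> carrier A \<Longrightarrow> z \<in> carrier A
   \<Longrightarrow> \<lbrace>x, y \<oplus>\<^bsub>A\<^esub> z\<rbrace>\<^bsub>A\<^esub> = \<lbrace>x, y\<rbrace>\<^bsub>A\<^esub> \<oplus>\<^bsub>A\<^esub> \<lbrace>x, z\<rbrace>\<^bsub>A\<^esub>"
  using bracket_derivation[of x] by (auto simp: derivation_def)

lemma bracket_smult_right: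
  "x \<in> carrier A \<Longrightarrow> c \<in> carrier K \<Longrightarrow> y \<in> carrier A
   \<Longrightarrow> \<lbrace>x, c \<odot>\<^bsub>A\<^esub> y\<rbrace>\<^bsub>A\<^esub> = c \<odot>\<^bsub>A\<^esub> \<lbrace>x, y\<rbrace>\<^bsub>A\<^esub>"
  using bracket_derivation[of x] by (auto simp: derivation_def)

lemma bracket_mult_right:
  "x \<in> carrier A \<Longrightarrow> y \<in> carrier A \<Longrightarrow> z \<in> carrier A
   \<Longrightarrow> \<lbrace>x, y \<otimes>\<^bsub>A\<^esub> z\<rbrace>\<^bsub>A\<^esub> = \<lbrace>x, y\<rbrace>\<^bsub>A\<^esub> \<otimes>\<^bsub>A\<^esub> z \<oplus>\<^bsub>A\<^esub> y \<otimes>\<^bsub>A\<^esub> \<lbrace>x, z\<rbrace>\<^bsub>A\<^esub>"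
  using bracket_derivation[of x] by (auto simp: derivation_def)

lemma bracket_zero_right: "x \<in> carrier A \<Longrightarrow> \<lbrace>x, \<zero>\<^bsub>A\<^esub>\<rbrace>\<^bsub>A\<^esub> = \<zero>\<^bsub>A\<^esub>"
  using bracket_smult_right[of x "\<zero>\<^bsub>K\<^esub>" "\<zero>\<^bsub>A\<^esub>"] bracket_closed by simp

lemma bracket_zero_left: "x \<in> carrier A \<Longrightarrow> \<lbrace>\<zero>\<^bsub>A\<^esub>, x\<rbrace>\<^bsub>A\<^esub> = \<zero>\<^bsub>A\<^esub>"
  using bracket_smult_left[of "\<zero>\<^bsub>K\<^esub>" "\<zero>\<^bsub>A\<^esub>" x] bracket_closed by simp

lemma bracket_one_right:
  assumes "x \<in> carrier A" shows "\<lbrace>x, \<one>\<^bsub>A\<^esub>\<rbrace>\<^bsub>A\<^esub> = \<zero>\<^bsub>A\<^esub>"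
proof -
  have c: "\<lbrace>x, \<one>\<^bsub>A\<^esub>\<rbrace>\<^bsub>A\<^esub> \<in> carrier A" using assms bracket_closed by simp
  have "\<lbrace>x, \<one>\<^bsub>A\<^esub>\<rbrace>\<^bsub>A\<^esub> = \<lbrace>x, \<one>\<^bsub>A\<^esub>\<rbrace>\<^bsub>A\<^esub> \<oplus>\<^bsub>A\<^esub> \<lbrace>x, \<one>\<^bsub>A\<^esub>\<rbrace>\<^bsub>A\<^esub>"
    using bracket_mult_right[of x "\<one>\<^bsub>A\<^esub>" "\<one>\<^bsub>A\<^esub>"] assms c by simp
  then show ?thesis using c by (metis M.add.l_cancel_one')
qed

lemma bracket_add_swap:
  assumes "x \<in> carrier A" "y \<in> carrier A"
  shows "\<lbrace>x, y\<rbrace>\<^bsub>A\<^esub> \<oplus>\<^bsub>A\<^esub> \<lbrace>y, x\<rbrace>\<^bsub>A\<^esub> = \<zero>\<^bsub>A\<^esub>"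
proof -
  have "\<zero>\<^bsub>A\<^esub> = \<lbrace>x \<oplus>\<^bsub>A\<^esub> y, x \<oplus>\<^bsub>A\<^esub> y\<rbrace>\<^bsub>A\<^esub>" using assms bracket_self by simp
  also have "\<dots> = \<lbrace>x, y\<rbrace>\<^bsub>A\<^esub> \<oplus>\<^bsub>A\<^esub> \<lbrace>y, x\<rbrace>\<^bsub>A\<^esub>"
    using assms by (simp add: bracket_add_left bracket_add_right bracket_closed)
      (simp add: bracket_self bracket_closed M.a_comm)
  finally show ?thesis by (rule sym)
qed

lemma UP_cring_A: "UP_cring A"
  using M_cring by (simp add: UP_cring_def)

lemma UP_carrier: "carrier (UP A) = up A"
  by (simp add: UP_def)

lemma UP_add: "p \<in> up A \<Longrightarrow> q \<in> up A \<Longrightarrow> p \<oplus>\<^bsub>UP A\<^esub> q = (\<lambda>i. p i \<oplus>\<^bsub>A\<^esub> q i)"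
  by (simp add: UP_def)

lemma UP_zero: "\<zero>\<^bsub>UP A\<^esub> = (\<lambda>i. \<zero>\<^bsub>A\<^esub>)"
  by (simp add: UP_def)

lemma UP_monom: "a \<in> carrier A \<Longrightarrow> monom (UP A) a n = (\<lambda>i. if i = n then a else \<zero>\<^bsub>A\<^esub>)"
  by (simp add: UP_def)

lemma UP_monom_closed: "a \<in> carrier A \<Longrightarrow> monom (UP A) a n \<in> up A"
proof -
  interpret U: UP_cring A "UP A" by (rule UP_cring_A)
  show "a \<in> carrier A \<Longrightarrow> ?thesis" using U.monom_closed[of a n] by (simp add: UP_carrier)
qed

lemma UP_monom_induct [consumes 1]:
  assumes p: "p \<in> up A"
    and monom: "\<And>a n. a \<in> carrier A \<Longrightarrow> Q (monom (UP A) a n)"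
    and add: "\<And>p q. p \<in> up A \<Longrightarrow> q \<in> up A \<Longrightarrow> Q p \<Longrightarrow> Q q \<Longrightarrow> Q (p \<oplus>\<^bsub>UP A\<^esub> q)"
  shows "Q p"
proof -
  have "Q p" if "p \<in> up A" "\<forall>m\<ge>n. p m = \<zero>\<^bsub>A\<^esub>" for n p
    using that
  proof (induction n arbitrary: p)
    case 0
    then have "p = monom (UP A) \<zero>\<^bsub>A\<^esub> 0" by (auto simp: UP_monom)
    then show ?case using monom by simp
  next
    case (Suc n)
    define q where "q = p(n := \<zero>\<^bsub>A\<^esub>)"
    have pc: "p i \<in> carrier A" for i using Suc.prems(1) by auto
    have "q m = \<zero>\<^bsub>A\<^esub>" if "m \<ge> n" for m
      using that Suc.prems(2)[rule_format, of m] by (cases "m = n") (auto simp: q_def)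
    then have q0: "\<forall>m\<ge>n. q m = \<zero>\<^bsub>A\<^esub>" by blast
    have q: "q \<in> up A"
    proof (rule mem_upI)
      show "q i \<in> carrier A" for i using pc by (simp add: q_def)
      show "\<exists>n. bound \<zero>\<^bsub>A\<^esub> n q" using q0 by (auto intro!: exI[of _ n])
    qed
    have "p = q \<oplus>\<^bsub>UP A\<^esub> monom (UP A) (p n) n"
    proof
      show "p i = (q \<oplus>\<^bsub>UP A\<^esub> monom (UP A) (p n) n) i" for i
        unfolding UP_add[OF q UP_monom_closed[OF pc]] using pc by (simp add: UP_monom q_def)
    qed
    then show ?case using add[OF q UP_monom_closed[OF pc]] Suc.IH[OF q q0] monom[OF pc]
      by metis
  qed
  moreover obtain n where "bound \<zero>\<^bsub>A\<^esub> n p" using p by (auto simp: up_def)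
  then have "\<forall>m\<ge>Suc n. p m = \<zero>\<^bsub>A\<^esub>" by (auto simp: Suc_le_eq)
  ultimately show ?thesis using p by blast
qed

abbreviation poly_bracket :: "(nat \<Rightarrow> 'a) \<Rightarrow> (nat \<Rightarrow> 'a) \<Rightarrow> nat \<Rightarrow> 'a" where
  "poly_bracket p q \<equiv> \<lbrace>p, q\<rbrace>\<^bsub>poisson_poly A\<^esub>"

lemma poly_bracket_closed:
  assumes "p \<in> up A" "q \<in> up A"
  shows "poly_bracket p q \<in> up A"
proof -
  obtain n where n: "bound \<zero>\<^bsub>A\<^esub> n p" using assms by (auto simp: up_def)
  obtain m where m: "bound \<zero>\<^bsub>A\<^esub> m q" using assms by (auto simp: up_def)
  have c: "\<lbrace>p i, q j\<rbrace>\<^bsub>A\<^esub> \<in> carrier A" for i j using assms by (auto intro: bracket_closed)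
  have z: "\<lbrace>p i, q (k - i)\<rbrace>\<^bsub>A\<^esub> = \<zero>\<^bsub>A\<^esub>" if "n + m < k" for i k
  proof (cases "n < i")
    case True
    then have "p i = \<zero>\<^bsub>A\<^esub>" using n by (rule bound.bound[rotated])
    then show ?thesis using assms(2) by (simp add: bracket_zero_left mem_upD)
  next
    case False
    then have "m < k - i" using that by simp
    then have "q (k - i) = \<zero>\<^bsub>A\<^esub>" using m by (rule bound.bound[rotated])
    then show ?thesis using assms(1) by (simp add: bracket_zero_right mem_upD)
  qed
  have "bound \<zero>\<^bsub>A\<^esub> (n + m) (poly_bracket p q)"
    by (rule bound.intro) (simp add: poisson_poly_sel z M.finsum_zero)
  then show ?thesis using c by (intro mem_upI) (auto simp: poisson_poly_sel)
qed

lemma poly_bracket_add_left: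
  assumes "p \<in> up A" "q \<in> up A" "r \<in> up A"
  shows "poly_bracket (p \<oplus>\<^bsub>UP A\<^esub> q) r = poly_bracket p r \<oplus>\<^bsub>UP A\<^esub> poly_bracket q r"
proof -
  have "p i \<in> carrier A" "q i \<in> carrier A" "r i \<in> carrier A" for i using assms by auto
  then show ?thesis
    using assms by (simp add: UP_add poly_bracket_closed)
      (simp add: poisson_poly_sel bracket_add_left bracket_closed M.finsum_addf Pi_def)
qed

lemma poly_bracket_add_right:
  assumes "p \<in> up A" "q \<in> up A" "r \<in> up A"
  shows "poly_bracket r (p \<oplus>\<^bsub>UP A\<^esub> q) = poly_bracket r p \<oplus>\<^bsub>UP A\<^esub> poly_bracket r q"
proof -
  have "p i \<in> carrier A" "q i \<in> carrier A" "r i \<in> carrier A" for i using assms by auto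
  then show ?thesis
    using assms by (simp add: UP_add poly_bracket_closed)
      (simp add: poisson_poly_sel bracket_add_right bracket_closed M.finsum_addf Pi_def)
qed

lemma poly_bracket_monom:
  assumes a: "a \<in> carrier A" and b: "b \<in> carrier A"
  shows "poly_bracket (monom (UP A) a i) (monom (UP A) b j) = monom (UP A) \<lbrace>a, b\<rbrace>\<^bsub>A\<^esub> (i + j)"
proof
  fix n
  have "\<lbrace>if l = i then a else \<zero>\<^bsub>A\<^esub>, if n - l = j then b else \<zero>\<^bsub>A\<^esub>\<rbrace>\<^bsub>A\<^esub>
      = (if i = l then if n - l = j then \<lbrace>a, b\<rbrace>\<^bsub>A\<^esub> else \<zero>\<^bsub>A\<^esub> else \<zero>\<^bsub>A\<^esub>)" for l
    using a b by (auto simp: bracket_zero_left bracket_zero_right)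
  then have eq: "poly_bracket (monom (UP A) a i) (monom (UP A) b j) n
      = (\<Oplus>\<^bsub>A\<^esub>l\<in>{..n}. if i = l then if n - l = j then \<lbrace>a, b\<rbrace>\<^bsub>A\<^esub> else \<zero>\<^bsub>A\<^esub> else \<zero>\<^bsub>A\<^esub>)"
    using a b by (simp add: poisson_poly_sel UP_monom)
  show "poly_bracket (monom (UP A) a i) (monom (UP A) b j) n = monom (UP A) \<lbrace>a, b\<rbrace>\<^bsub>A\<^esub> (i + j) n"
  proof (cases "i \<le> n")
    case True
    have "(\<Oplus>\<^bsub>A\<^esub>l\<in>{..n}. if i = l then if n - l = j then \<lbrace>a, b\<rbrace>\<^bsub>A\<^esub> else \<zero>\<^bsub>A\<^esub> else \<zero>\<^bsub>A\<^esub>)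
        = (if n - i = j then \<lbrace>a, b\<rbrace>\<^bsub>A\<^esub> else \<zero>\<^bsub>A\<^esub>)"
      using True a b by (intro M.add.finprod_singleton) (auto simp: bracket_closed)
    then show ?thesis unfolding eq using True a b by (auto simp: UP_monom bracket_closed)
  next
    case False
    then have "(\<Oplus>\<^bsub>A\<^esub>l\<in>{..n}. if i = l then if n - l = j then \<lbrace>a, b\<rbrace>\<^bsub>A\<^esub> else \<zero>\<^bsub>A\<^esub> else \<zero>\<^bsub>A\<^esub>)
        = (\<Oplus>\<^bsub>A\<^esub>l\<in>{..n}. \<zero>\<^bsub>A\<^esub>)"
      by (intro M.add.finprod_cong') auto
    then show ?thesis unfolding eq using False a b by (auto simp: UP_monom bracket_closed)
  qed
qed

lemma poly_bracket_const:
  "a \<in> carrier A \<Longrightarrow> b \<in> carrier A \<Longrightarrow>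
   poly_bracket (monom (UP A) a 0) (monom (UP A) b 0) = monom (UP A) \<lbrace>a, b\<rbrace>\<^bsub>A\<^esub> 0"
  by (simp add: poly_bracket_monom)

lemma poly_bracket_var_const:
  assumes "a \<in> carrier A"
  shows "poly_bracket (monom (UP A) \<one>\<^bsub>A\<^esub> 1) (monom (UP A) a 0) = \<zero>\<^bsub>UP A\<^esub>"
proof -
  have "\<lbrace>\<one>\<^bsub>A\<^esub>, a\<rbrace>\<^bsub>A\<^esub> = \<zero>\<^bsub>A\<^esub>"
    using bracket_add_swap[OF assms one_closed] assms
    by (simp add: bracket_one_right bracket_closed)
  then show ?thesis using assms by (simp add: poly_bracket_monom) (simp add: UP_monom UP_zero)
qed

lemma poly_bracket_swap:
  assumes p: "p \<in> up A" and q: "q \<in> up A"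
  shows "poly_bracket p q \<oplus>\<^bsub>UP A\<^esub> poly_bracket q p = \<zero>\<^bsub>UP A\<^esub>"
  using p
proof (induct p rule: UP_monom_induct)
  case (1 a n)
  interpret U: UP_cring A "UP A" by (rule UP_cring_A)
  note a = \<open>a \<in> carrier A\<close>
  show ?case using q
  proof (induct q rule: UP_monom_induct)
    case (1 b m)
    then show ?case using a
      by (simp add: poly_bracket_monom bracket_closed bracket_add_swap add.commute[of m n]
          flip: U.monom_add)
  next
    case (2 q r)
    let ?m = "monom (UP A) a n"
    note m = UP_monom_closed[OF a, of n]
    note c = poly_bracket_closed[folded UP_carrier] 2(1,2)[folded UP_carrier] m[folded UP_carrier]
    have "poly_bracket ?m (q \<oplus>\<^bsub>UP A\<^esub> r) \<oplus>\<^bsub>UP A\<^esub> poly_bracket (q \<oplus>\<^bsub>UP A\<^esub> r) ?m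
      = (poly_bracket ?m q \<oplus>\<^bsub>UP A\<^esub> poly_bracket q ?m)
        \<oplus>\<^bsub>UP A\<^esub> (poly_bracket ?m r \<oplus>\<^bsub>UP A\<^esub> poly_bracket r ?m)"
      using 2(1,2) m c by (simp add: poly_bracket_add_left poly_bracket_add_right U.P.a_ac)
    then show ?case using 2(3,4) by simp
  qed
next
  case (2 r s)
  interpret U: UP_cring A "UP A" by (rule UP_cring_A)
  note c = poly_bracket_closed[folded UP_carrier] 2(1,2)[folded UP_carrier] q[folded UP_carrier]
  have "poly_bracket (r \<oplus>\<^bsub>UP A\<^esub> s) q \<oplus>\<^bsub>UP A\<^esub> poly_bracket q (r \<oplus>\<^bsub>UP A\<^esub> s)
    = (poly_bracket r q \<oplus>\<^bsub>UP A\<^esub> poly_bracket q r)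
      \<oplus>\<^bsub>UP A\<^esub> (poly_bracket s q \<oplus>\<^bsub>UP A\<^esub> poly_bracket q s)"
    using 2(1,2) q c by (simp add: poly_bracket_add_left poly_bracket_add_right U.P.a_ac)
  then show ?case using 2(3,4) by simp
qed

lemma poly_bracket_self:
  assumes "p \<in> up A"
  shows "poly_bracket p p = \<zero>\<^bsub>UP A\<^esub>"
  using assms
proof (induct p rule: UP_monom_induct)
  case (1 a n)
  interpret U: UP_cring A "UP A" by (rule UP_cring_A)
  show ?case using 1 by (simp add: poly_bracket_monom bracket_self)
next
  case (2 p q)
  interpret U: UP_cring A "UP A" by (rule UP_cring_A)
  note c = poly_bracket_closed[folded UP_carrier] 2(1,2)[folded UP_carrier]
  show ?case using 2 c poly_bracket_swap[OF 2(1,2)] poly_bracket_swap[OF 2(2,1)]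
    by (simp add: poly_bracket_add_left poly_bracket_add_right U.P.a_closed[unfolded UP_carrier])
qed

lemma UP_monom_induct3 [consumes 3]:
  assumes pqr: "p \<in> up A" "q \<in> up A" "r \<in> up A"
    and monom: "\<And>a b c i j k. a \<in> carrier A \<Longrightarrow> b \<in> carrier A \<Longrightarrow> c \<in> carrier A
      \<Longrightarrow> Q (monom (UP A) a i) (monom (UP A) b j) (monom (UP A) c k)"
    and add1: "\<And>p p' q r. p \<in> up A \<Longrightarrow> p' \<in> up A \<Longrightarrow> q \<in> up A \<Longrightarrow> r \<in> up A
      \<Longrightarrow> Q p q r \<Longrightarrow> Q p' q r \<Longrightarrow> Q (p \<oplus>\<^bsub>UP A\<^esub> p') q r"
    and add2: "\<And>p q q' r. p \<in> up A \<Longrightarrow> q \<in> up A \<Longrightarrow> q' \<in> up A \<Longrightarrow> r \<in> up A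
      \<Longrightarrow> Q p q r \<Longrightarrow> Q p q' r \<Longrightarrow> Q p (q \<oplus>\<^bsub>UP A\<^esub> q') r"
    and add3: "\<And>p q r r'. p \<in> up A \<Longrightarrow> q \<in> up A \<Longrightarrow> r \<in> up A \<Longrightarrow> r' \<in> up A
      \<Longrightarrow> Q p q r \<Longrightarrow> Q p q r' \<Longrightarrow> Q p q (r \<oplus>\<^bsub>UP A\<^esub> r')"
  shows "Q p q r"
proof -
  have 1: "Q (monom (UP A) a i) (monom (UP A) b j) r" if "a \<in> carrier A" "b \<in> carrier A" for a b i j
    using pqr(3)
    by (induct r rule: UP_monom_induct) (auto intro: monom add3 UP_monom_closed that)
  have 2: "Q (monom (UP A) a i) q r" if "a \<in> carrier A" for a i
    using pqr(2)
    by (induct q rule: UP_monom_induct) (auto intro: 1 add2 UP_monom_closed that pqr)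
  show ?thesis
    using pqr(1)
    by (induct p rule: UP_monom_induct) (auto intro: 2 add1 UP_monom_closed pqr)
qed

lemma poly_bracket_jacobi:
  assumes "p \<in> up A" "q \<in> up A" "r \<in> up A"
  shows "poly_bracket p (poly_bracket q r) \<oplus>\<^bsub>UP A\<^esub> poly_bracket q (poly_bracket r p)
    \<oplus>\<^bsub>UP A\<^esub> poly_bracket r (poly_bracket p q) = \<zero>\<^bsub>UP A\<^esub>"
proof -
  interpret U: UP_cring A "UP A" by (rule UP_cring_A)
  let ?J = "\<lambda>p q r. poly_bracket p (poly_bracket q r) \<oplus>\<^bsub>UP A\<^esub> poly_bracket q (poly_bracket r p)
    \<oplus>\<^bsub>UP A\<^esub> poly_bracket r (poly_bracket p q)"
  note [simp] = UP_carrier poly_bracket_closed poly_bracket_add_left poly_bracket_add_right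
    U.P.a_closed[unfolded UP_carrier]
  note ac = U.P.a_ac[unfolded UP_carrier] U.P.l_zero[unfolded UP_carrier]
    U.P.zero_closed[unfolded UP_carrier]
  have J1: "?J (p \<oplus>\<^bsub>UP A\<^esub> p') q r = ?J p q r \<oplus>\<^bsub>UP A\<^esub> ?J p' q r"
    if "p \<in> up A" "p' \<in> up A" "q \<in> up A" "r \<in> up A" for p p' q r
    using that by (simp add: ac)
  have rot: "?J p q r = ?J q r p" if "p \<in> up A" "q \<in> up A" "r \<in> up A" for p q r
    using that by (simp add: ac)
  show ?thesis
    using assms
  proof (induct p q r rule: UP_monom_induct3)
    case (1 a b c i j k)
    have e: "j + (k + i) = i + (j + k)" "k + (i + j) = i + (j + k)" by simp_all
    show ?case using 1 bracket_jacobi[of a b c]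
      by (simp add: poly_bracket_monom bracket_closed e flip: U.monom_add)
  next
    case (2 p p' q r)
    show ?case unfolding J1[OF 2(1-4)] 2(5,6) by (simp add: ac)
  next
    case (3 p q q' r)
    have "?J p (q \<oplus>\<^bsub>UP A\<^esub> q') r = ?J (q \<oplus>\<^bsub>UP A\<^esub> q') r p"
      using 3(1-4) by (intro rot) auto
    also have "\<dots> = ?J p q r \<oplus>\<^bsub>UP A\<^esub> ?J p q' r"
      unfolding J1[OF 3(2,3,4,1)] rot[OF 3(1,2,4)] rot[OF 3(1,3,4)] ..
    finally show ?case unfolding 3(5,6) by (simp add: ac)
  next
    case (4 p q r r')
    have "?J p q (r \<oplus>\<^bsub>UP A\<^esub> r') = ?J (r \<oplus>\<^bsub>UP A\<^esub> r') p q"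
      using 4(1-4) by (intro rot[symmetric]) auto
    also have "\<dots> = ?J p q r \<oplus>\<^bsub>UP A\<^esub> ?J p q r'"
      unfolding J1[OF 4(3,4,1,2)] rot[OF 4(3,1,2)] rot[OF 4(4,1,2)] ..
    finally show ?case unfolding 4(5,6) by (simp add: ac)
  qed
qed

lemma poly_bracket_mult_right:
  assumes "p \<in> up A" "q \<in> up A" "r \<in> up A"
  shows "poly_bracket p (q \<otimes>\<^bsub>UP A\<^esub> r)
    = poly_bracket p q \<otimes>\<^bsub>UP A\<^esub> r \<oplus>\<^bsub>UP A\<^esub> q \<otimes>\<^bsub>UP A\<^esub> poly_bracket p r"
proof -
  interpret U: UP_cring A "UP A" by (rule UP_cring_A)
  note [simp] = poly_bracket_closed poly_bracket_add_left poly_bracket_add_right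
    U.P.a_closed[unfolded UP_carrier] U.P.m_closed[unfolded UP_carrier]
    U.P.l_distr[unfolded UP_carrier] U.P.r_distr[unfolded UP_carrier]
  note ac = U.P.a_ac[unfolded UP_carrier]
  show ?thesis
    using assms
  proof (induct p q r rule: UP_monom_induct3)
    case (1 a b c i j k)
    have "monom (UP A) b j \<otimes>\<^bsub>UP A\<^esub> monom (UP A) \<lbrace>a, c\<rbrace>\<^bsub>A\<^esub> (i + k)
      = monom (UP A) (b \<otimes>\<^bsub>A\<^esub> \<lbrace>a, c\<rbrace>\<^bsub>A\<^esub>) (i + (j + k))"
      using U.monom_mult[of b "\<lbrace>a, c\<rbrace>\<^bsub>A\<^esub>" j "i + k"] 1
      by (simp add: bracket_closed add.left_commute del: U.monom_mult)
    moreover have "monom (UP A) \<lbrace>a, b\<rbrace>\<^bsub>A\<^esub> (i + j) \<otimes>\<^bsub>UP A\<^esub> monom (UP A) c k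
      = monom (UP A) (\<lbrace>a, b\<rbrace>\<^bsub>A\<^esub> \<otimes>\<^bsub>A\<^esub> c) (i + (j + k))"
      using U.monom_mult[of "\<lbrace>a, b\<rbrace>\<^bsub>A\<^esub>" c "i + j" k] 1
      by (simp add: bracket_closed add.assoc del: U.monom_mult)
    ultimately show ?case using 1
      by (simp add: poly_bracket_monom bracket_closed bracket_mult_right
          del: U.monom_mult U.monom_add flip: U.monom_mult[of b c j k] U.monom_add)
  next
    case 2
    then show ?case by (simp add: ac)
  next
    case 3
    then show ?case by (simp add: ac)
  next
    case 4
    then show ?case by (simp add: ac)
  qed
qed

lemma up_scalar_closed:
  assumes "c \<in> carrier K" "p \<in> up A"
  shows "(\<lambda>n. c \<odot>\<^bsub>A\<^esub> p n) \<in> up A"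
proof -
  obtain n where "bound \<zero>\<^bsub>A\<^esub> n p" using assms by (auto simp: up_def)
  then have "bound \<zero>\<^bsub>A\<^esub> n (\<lambda>n. c \<odot>\<^bsub>A\<^esub> p n)"
    using assms by (auto simp: bound_def)
  then show ?thesis using assms by (intro mem_upI) auto
qed

lemma finsum_smult:
  assumes "finite I" "c \<in> carrier K" "f \<in> I \<rightarrow> carrier A"
  shows "c \<odot>\<^bsub>A\<^esub> (\<Oplus>\<^bsub>A\<^esub>i\<in>I. f i) = (\<Oplus>\<^bsub>A\<^esub>i\<in>I. c \<odot>\<^bsub>A\<^esub> f i)"
proof -
  show ?thesis using assms
    by (induction I rule: finite_induct) (auto simp: smult_r_distr Pi_def)
qed

theorem poisson_poly_algebra: "poisson_algebra K (poisson_poly A)"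
proof -
  interpret U: UP_cring A "UP A" by (rule UP_cring_A)
  have cr: "cring (poisson_poly A)"
    using U.P.add.l_inv_ex
    by (intro cringI abelian_groupI comm_monoidI)
      (auto simp: poisson_poly_sel U.P.a_ac U.P.m_ac U.P.l_distr U.P.r_distr)
  have sl: "poly_bracket (\<lambda>n. c \<odot>\<^bsub>A\<^esub> p n) q = (\<lambda>n. c \<odot>\<^bsub>A\<^esub> poly_bracket p q n)"
    if "c \<in> carrier K" "p \<in> up A" "q \<in> up A" for c p q
  proof -
    have "p i \<in> carrier A" "q i \<in> carrier A" for i using that by auto
    then show ?thesis using that(1)
      by (simp add: poisson_poly_sel finsum_smult bracket_smult_left bracket_closed)
  qed
  have sr: "poly_bracket q (\<lambda>n. c \<odot>\<^bsub>A\<^esub> p n) = (\<lambda>n. c \<odot>\<^bsub>A\<^esub> poly_bracket q p n)"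
    if "c \<in> carrier K" "p \<in> up A" "q \<in> up A" for c p q
  proof -
    have "p i \<in> carrier A" "q i \<in> carrier A" for i using that by auto
    then show ?thesis using that(1)
      by (simp add: poisson_poly_sel finsum_smult bracket_smult_right bracket_closed)
  qed
  have sm: "(\<lambda>n. c \<odot>\<^bsub>A\<^esub> p n) \<otimes>\<^bsub>UP A\<^esub> q = (\<lambda>n. c \<odot>\<^bsub>A\<^esub> (p \<otimes>\<^bsub>UP A\<^esub> q) n)"
    if "c \<in> carrier K" "p \<in> up A" "q \<in> up A" for c p q
  proof -
    have pq: "p i \<in> carrier A" "q i \<in> carrier A" for i using that by auto
    have s: "(\<lambda>n. c \<odot>\<^bsub>A\<^esub> p n) \<in> up A" using that by (intro up_scalar_closed)
    show ?thesis using that s pq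
      by (simp add: UP_def finsum_smult smult_assoc2)
  qed
  have alg: "algebra K (poisson_poly A)"
  proof (rule algebraI)
    show "cring K" by (rule R_cring)
    show "cring (poisson_poly A)" by (rule cr)
  qed (auto simp: poisson_poly_sel UP_carrier UP_add up_scalar_closed sm smult_l_distr
      smult_r_distr smult_assoc1 mem_upD)
  show ?thesis
  proof (intro poisson_algebra.intro alg poisson_algebra_axioms.intro)
    fix p assume p: "p \<in> carrier (poisson_poly A)"
    show "derivation K (poisson_poly A) (poly_bracket p)"
      using p by (auto simp: derivation_def poisson_poly_sel(1-6) UP_carrier poly_bracket_closed
          poly_bracket_add_right poly_bracket_mult_right sr)
  qed (auto simp: poisson_poly_sel(1-6) UP_carrier poly_bracket_add_left sl poly_bracket_self
      poly_bracket_jacobi)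
qed

end

end

theory Submission
  imports Defs
begin

text \<open>
  Let \<open>\<phi> : A[t] \<rightarrow> B[t]\<close> be an isomorphism of Poisson algebras.  It suffices that \<open>\<phi>\<close> maps \<open>A\<close> onto
  \<open>B\<close>.  The subalgebra \<open>B\<close> of \<open>B[t]\<close> is the kernel of \<open>d/dt\<close>, a locally nilpotent Poisson derivation;
  so its preimage is the kernel of the derivation \<open>D\<close> of \<open>A[t]\<close> corresponding to \<open>d/dt\<close>, and the
  claim is that \<open>ker D = A\<close>.

  The inclusion \<open>A \<subseteq> ker D\<close> is Makar-Limanov's degree argument
  (\<open>rigid_imp_constants_in_kernel\<close>).  As \<open>A\<close> is finitely generated, \<open>D\<close> raises the degree in \<open>t\<close> by at
  most some \<open>d \<ge> 0\<close>.  Its part of degree \<open>d\<close> is a homogeneous locally nilpotent derivation, sending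
  \<open>a\<close> in \<open>A\<close> to \<open>\<delta> a t^d\<close> and \<open>t\<close> to \<open>f t^(d + 1)\<close>.  A locally nilpotent derivation of a domain of
  characteristic zero cannot send a nonzero element to a nonzero multiple of itself
  (\<open>not_own_divisor\<close>), whence \<open>f = 0\<close>.  Then \<open>\<delta>\<close> is a locally nilpotent Poisson derivation of \<open>A\<close>, so
  it is zero by hypothesis.  Thus \<open>D\<close> raises the degree by at most \<open>d - 1\<close>, and by descent \<open>D\<close> lowers
  the degree, which means that it kills \<open>A\<close>.

  Conversely, a derivation of \<open>A[t]\<close> that kills \<open>A\<close> is \<open>p \<mapsto> p' D t\<close>, and \<open>D\<close> is nonzero because
  \<open>d/dt\<close> is.  So \<open>D p = 0\<close> forces \<open>p' = 0\<close>, that is, \<open>p\<close> lies in \<open>A\<close>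
  (\<open>kernel_eq_constants\<close>).
\<close>

section \<open>Weighted sums\<close>

lemma (in abelian_monoid) finsum_add_pow:
  assumes "g \<in> I \<rightarrow> carrier G" "finite I"
  shows "[(k::nat)] \<cdot> (\<Oplus>i\<in>I. g i) = (\<Oplus>i\<in>I. [k] \<cdot> g i)"
  using assms(2,1)
  by (induction I rule: finite_induct)
    (auto simp: Pi_def add.nat_pow_distrib)

text \<open>
  The Leibniz rule for \<open>d/dt\<close> on one coefficient: in a sum of terms of total degree \<open>Suc n\<close>, the
  \<open>i\<close>-th term is counted \<open>i\<close> times by differentiating the left factor and \<open>Suc n - i\<close> times by
  differentiating the right one.
\<close>

lemma (in abelian_monoid) finsum_weighted_split:
  assumes g: "g \<in> {..Suc n} \<rightarrow> carrier G"
  shows "(\<Oplus>i\<in>{..n}. [Suc i] \<cdot> g (Suc i)) \<oplus> (\<Oplus>i\<in>{..n}. [Suc (n - i)] \<cdot> g i)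
    = [Suc n] \<cdot> (\<Oplus>i\<in>{..Suc n}. g i)"
proof -
  have gc: "g i \<in> carrier G" if "i \<le> Suc n" for i using g that by auto
  have 1: "(\<Oplus>i\<in>{..n}. [Suc i] \<cdot> g (Suc i)) = (\<Oplus>i\<in>{..Suc n}. [i] \<cdot> g i)"
    using gc by (subst finsum_Suc2) (auto simp del: add.nat_pow_Suc)
  have "(\<Oplus>i\<in>{..n}. [Suc (n - i)] \<cdot> g i) = (\<Oplus>i\<in>{..n}. [(Suc n - i)] \<cdot> g i)"
    using gc by (intro add.finprod_cong') (auto simp: Suc_diff_le simp del: add.nat_pow_Suc)
  also have "\<dots> = (\<Oplus>i\<in>{..Suc n}. [(Suc n - i)] \<cdot> g i)"
    using gc by (subst finsum_Suc) (auto simp del: add.nat_pow_Suc)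
  finally have 2: "(\<Oplus>i\<in>{..n}. [Suc (n - i)] \<cdot> g i) = (\<Oplus>i\<in>{..Suc n}. [(Suc n - i)] \<cdot> g i)" .
  have "(\<Oplus>i\<in>{..Suc n}. [i] \<cdot> g i) \<oplus> (\<Oplus>i\<in>{..Suc n}. [(Suc n - i)] \<cdot> g i)
    = (\<Oplus>i\<in>{..Suc n}. [i] \<cdot> g i \<oplus> [(Suc n - i)] \<cdot> g i)"
    using gc by (intro finsum_addf[symmetric]) auto
  also have "\<dots> = (\<Oplus>i\<in>{..Suc n}. [Suc n] \<cdot> g i)"
    using gc by (intro add.finprod_cong') (auto simp: add.nat_pow_mult simp del: add.nat_pow_Suc)
  also have "\<dots> = [Suc n] \<cdot> (\<Oplus>i\<in>{..Suc n}. g i)"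
    using g by (intro finsum_add_pow[symmetric]) auto
  finally show ?thesis unfolding 1 2 .
qed

section \<open>Homogeneous locally nilpotent derivations\<close>

text \<open>
  A derivation of \<open>R[t]\<close> that is homogeneous of degree \<open>d\<close> sends \<open>a t^k\<close> to \<open>E k a t^(k + d)\<close>.
  Only its values on homogeneous elements matter below, so it is encoded by the family \<open>E\<close> alone;
  \<open>iter n k a\<close> is then the coefficient of its \<open>n\<close>-th iterate at \<open>a t^k\<close>.
\<close>

locale graded_derivation = cring R for R (structure) +
  fixes E :: "nat \<Rightarrow> 'a \<Rightarrow> 'a" and d :: nat
  assumes E_closed [simp]: "a \<in> carrier R \<Longrightarrow> E k a \<in> carrier R"
    and E_add: "\<lbrakk>a \<in> carrier R; b \<in> carrier R\<rbrakk> \<Longrightarrow> E k (a \<oplus> b) = E k a \<oplus> E k b"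
    and E_mult: "\<lbrakk>a \<in> carrier R; b \<in> carrier R\<rbrakk>
      \<Longrightarrow> E (k + l) (a \<otimes> b) = E k a \<otimes> b \<oplus> a \<otimes> E l b"
begin

fun iter :: "nat \<Rightarrow> nat \<Rightarrow> 'a \<Rightarrow> 'a" where
  "iter 0 k a = a"
| "iter (Suc n) k a = iter n (k + d) (E k a)"

lemma iter_closed [simp]: "a \<in> carrier R \<Longrightarrow> iter n k a \<in> carrier R"
  by (induction n arbitrary: k a) auto

lemma iter_add:
  "\<lbrakk>a \<in> carrier R; b \<in> carrier R\<rbrakk> \<Longrightarrow> iter n k (a \<oplus> b) = iter n k a \<oplus> iter n k b"
  by (induction n arbitrary: k a b) (auto simp: E_add)

lemma E_zero [simp]: "E k \<zero> = \<zero>"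
  using E_add[of \<zero> \<zero> k] by (simp add: add.r_cancel_one')

lemma iter_zero [simp]: "iter n k \<zero> = \<zero>"
  by (induction n arbitrary: k) auto

lemma iter_plus: "iter (m + n) k a = iter n (k + m * d) (iter m k a)"
  by (induction m arbitrary: k a) (auto simp: algebra_simps)

text \<open>
  For a locally nilpotent derivation \<open>D\<close> let the order of \<open>x\<close> be the last \<open>n\<close> with \<open>D^n x\<close> nonzero.
  In the Leibniz expansion of \<open>D^(m + n) (x y)\<close>, with \<open>m\<close> and \<open>n\<close> bounding the orders of \<open>x\<close> and
  \<open>y\<close>, only the term with exactly \<open>m\<close> factors \<open>D\<close> on \<open>x\<close> survives.  Its binomial coefficient enters
  only through being positive, and an induction on \<open>m + n\<close> delivers it without the full Leibniz
  formula.  Over a torsion-free domain this makes the order additive on products.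
\<close>

lemma iter_last_mult:
  assumes "a \<in> carrier R" "b \<in> carrier R"
    and "iter (Suc m) k a = \<zero>" "iter (Suc n) l b = \<zero>"
  shows "\<exists>c>0. iter (m + n) (k + l) (a \<otimes> b) = [(c::nat)] \<cdot> (iter m k a \<otimes> iter n l b)"
  using assms
proof (induction "m + n" arbitrary: m n k l a b)
  case 0
  then show ?case by (auto intro!: exI[of _ 1])
next
  case (Suc N)
  have ac: "a \<in> carrier R" "b \<in> carrier R" by fact+
  have step: "iter (m + n) (k + l) (a \<otimes> b)
      = iter N ((k + d) + l) (E k a \<otimes> b) \<oplus> iter N (k + (l + d)) (a \<otimes> E l b)"
    using ac by (simp add: E_mult iter_add Suc.hyps(2)[symmetric] add_ac)
  show ?case
  proof (cases m)
    case 0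
    then obtain n' where n: "n = Suc n'" "N = n'" using Suc.hyps(2) by auto
    have Ek: "E k a = \<zero>" using Suc.prems(3) 0 by simp
    obtain c where "c > 0" "iter N (k + (l + d)) (a \<otimes> E l b) = [(c::nat)] \<cdot> (a \<otimes> iter n l b)"
      using Suc.hyps(1)[of 0 n' a "E l b" k "l + d"] Suc.prems 0 n by auto
    then show ?thesis using step Ek 0 ac by auto
  next
    case (Suc m')
    note m = this
    obtain c1 where c1: "c1 > 0"
      "iter N ((k + d) + l) (E k a \<otimes> b) = [(c1::nat)] \<cdot> (iter m k a \<otimes> iter n l b)"
      using Suc.hyps(1)[of m' n "E k a" b "k + d" l] Suc.hyps(2) Suc.prems m by auto
    show ?thesis
    proof (cases n)
      case 0
      then have "E l b = \<zero>" using Suc.prems(4) by simp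
      then show ?thesis using step c1 ac by auto
    next
      case (Suc n')
      obtain c2 where c2: "c2 > 0"
        "iter N (k + (l + d)) (a \<otimes> E l b) = [(c2::nat)] \<cdot> (iter m k a \<otimes> iter n l b)"
        using Suc.hyps(1)[of m n' a "E l b" k "l + d"] Suc.hyps(2) Suc.prems Suc by auto
      show ?thesis unfolding step c1(2) c2(2) using c1(1) ac
        by (intro exI[of _ "c1 + c2"]) (simp add: add.nat_pow_mult)
    qed
  qed
qed

text \<open>
  A nonzero \<open>x\<close> cannot divide a nonzero \<open>D x\<close> when \<open>D\<close> is locally nilpotent: the order of \<open>D x\<close> is
  one less than that of \<open>x\<close>, whereas by additivity the order of \<open>x y\<close> is at least that of \<open>x\<close>.
  Here \<open>x = a t^k\<close>, and the cofactor \<open>b\<close> has degree \<open>d\<close>.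
\<close>

lemma not_own_divisor:
  assumes dom: "\<And>x y. \<lbrakk>x \<in> carrier R; y \<in> carrier R; x \<otimes> y = \<zero>\<rbrakk> \<Longrightarrow> x = \<zero> \<or> y = \<zero>"
    and tf: "\<And>x n. \<lbrakk>x \<in> carrier R; (n::nat) > 0; [n] \<cdot> x = \<zero>\<rbrakk> \<Longrightarrow> x = \<zero>"
    and nil: "\<And>x k. x \<in> carrier R \<Longrightarrow> \<exists>n. iter n k x = \<zero>"
    and ab: "a \<in> carrier R" "b \<in> carrier R" "E k a = a \<otimes> b"
  shows "a = \<zero> \<or> b = \<zero>"
proof (rule ccontr)
  assume nz: "\<not> (a = \<zero> \<or> b = \<zero>)"
  have last: "\<exists>m. iter m k x \<noteq> \<zero> \<and> iter (Suc m) k x = \<zero>" if "x \<in> carrier R" "x \<noteq> \<zero>" for x k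
    using ex_least_nat_less[of "\<lambda>n. iter n k x = \<zero>"] nil[OF that(1), of k] that(2)
    by (metis iter.simps(1) lessI less_Suc_eq_le)
  obtain m where m: "iter m k a \<noteq> \<zero>" "iter (Suc m) k a = \<zero>" using last[of a k] ab nz by blast
  obtain n where n: "iter n d b \<noteq> \<zero>" "iter (Suc n) d b = \<zero>" using last[of b d] ab nz by blast
  obtain c where c: "c > 0"
    "iter (m + n) (k + d) (a \<otimes> b) = [(c::nat)] \<cdot> (iter m k a \<otimes> iter n d b)"
    using iter_last_mult[OF ab(1,2) m(2) n(2)] by blast
  \<comment> \<open>As the derivation sends \<open>a t^k\<close> to \<open>a b t^(k + d)\<close>, the \<open>(m + n)\<close>-th iterate on the latter is
    the \<open>(m + n + 1)\<close>-st on the former, hence zero.\<close>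
  have "iter (m + n) (k + d) (a \<otimes> b) = iter (Suc m + n) k a" using ab by simp
  also have "\<dots> = \<zero>" unfolding iter_plus m(2) by simp
  finally show False using c tf[of "iter m k a \<otimes> iter n d b" c] dom[of "iter m k a" "iter n d b"] m n ab
    by auto
qed

end

section \<open>Torsion-freeness in characteristic zero\<close>

context poisson_algebra
begin

lemma add_pow_smult_one:
  assumes "x \<in> carrier A"
  shows "[(n::nat)] \<cdot>\<^bsub>A\<^esub> x = ([n] \<cdot>\<^bsub>K\<^esub> \<one>\<^bsub>K\<^esub>) \<odot>\<^bsub>A\<^esub> x"
  using assms by (induction n) (auto simp: smult_l_distr)

text \<open>
  Characteristic zero enters the argument only in this form.
\<close>

lemma add_pow_torsion_free:
  assumes "field K" "char_zero K" "x \<in> carrier A" "(n::nat) > 0" "[n] \<cdot>\<^bsub>A\<^esub> x = \<zero>\<^bsub>A\<^esub>"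
  shows "x = \<zero>\<^bsub>A\<^esub>"
proof -
  let ?c = "[n] \<cdot>\<^bsub>K\<^esub> \<one>\<^bsub>K\<^esub>"
  have "?c \<in> Units K"
    using assms(1,2,4) by (simp add: char_zero_def field.field_Units)
  then have i: "inv\<^bsub>K\<^esub> ?c \<in> carrier K" "inv\<^bsub>K\<^esub> ?c \<otimes>\<^bsub>K\<^esub> ?c = \<one>\<^bsub>K\<^esub>" by auto
  have "x = (inv\<^bsub>K\<^esub> ?c \<otimes>\<^bsub>K\<^esub> ?c) \<odot>\<^bsub>A\<^esub> x" using assms i by simp
  also have "\<dots> = inv\<^bsub>K\<^esub> ?c \<odot>\<^bsub>A\<^esub> ([n] \<cdot>\<^bsub>A\<^esub> x)"
    using assms(3) i(1) by (subst smult_assoc1) (simp_all add: add_pow_smult_one)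
  finally show ?thesis using assms(5) i by simp
qed

end

section \<open>The derivation \<open>d/dt\<close> of a polynomial Poisson algebra\<close>

definition formal_deriv :: "('a, 'm) ring_scheme \<Rightarrow> (nat \<Rightarrow> 'a) \<Rightarrow> nat \<Rightarrow> 'a" where
  "formal_deriv R p n = [Suc n] \<cdot>\<^bsub>R\<^esub> p (Suc n)"

text \<open>
  The product and the Poisson bracket of polynomials are both convolutions along a biadditive
  operation \<open>\<beta>\<close>, so one computation yields the Leibniz rule for either.
\<close>

lemma (in abelian_group) formal_deriv_convolution:
  assumes p: "\<And>i. p i \<in> carrier G" and q: "\<And>i. q i \<in> carrier G"
    and cl: "\<And>x y. \<lbrakk>x \<in> carrier G; y \<in> carrier G\<rbrakk> \<Longrightarrow> \<beta> x y \<in> carrier G"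
    and l: "\<And>x y k. \<lbrakk>x \<in> carrier G; y \<in> carrier G\<rbrakk> \<Longrightarrow> \<beta> ([(k::nat)] \<cdot> x) y = [k] \<cdot> \<beta> x y"
    and r: "\<And>x y k. \<lbrakk>x \<in> carrier G; y \<in> carrier G\<rbrakk> \<Longrightarrow> \<beta> x ([(k::nat)] \<cdot> y) = [k] \<cdot> \<beta> x y"
  shows "[Suc n] \<cdot> (\<Oplus>i\<in>{..Suc n}. \<beta> (p i) (q (Suc n - i)))
    = (\<Oplus>i\<in>{..n}. \<beta> (formal_deriv G p i) (q (n - i)))
      \<oplus> (\<Oplus>i\<in>{..n}. \<beta> (p i) (formal_deriv G q (n - i)))"
proof -
  define g where "g i = \<beta> (p i) (q (Suc n - i))" for i
  have g: "g i \<in> carrier G" for i using p q cl by (simp add: g_def)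
  have 1: "(\<Oplus>i\<in>{..n}. \<beta> (formal_deriv G p i) (q (n - i))) = (\<Oplus>i\<in>{..n}. [Suc i] \<cdot> g (Suc i))"
    using p q g by (intro add.finprod_cong')
      (auto simp: formal_deriv_def g_def l cl simp del: add.nat_pow_Suc)
  have 2: "(\<Oplus>i\<in>{..n}. \<beta> (p i) (formal_deriv G q (n - i))) = (\<Oplus>i\<in>{..n}. [Suc (n - i)] \<cdot> g i)"
    using p q g by (intro add.finprod_cong')
      (auto simp: formal_deriv_def g_def r Suc_diff_le simp del: add.nat_pow_Suc)
  show ?thesis unfolding 1 2 using finsum_weighted_split[of g n] g
    by (simp add: g_def Pi_def del: add.nat_pow_Suc)
qed

context poisson_algebra
begin

lemma UP_mult:
  "p \<in> up A \<Longrightarrow> q \<in> up A \<Longrightarrow> (p \<otimes>\<^bsub>UP A\<^esub> q) n = (\<Oplus>\<^bsub>A\<^esub>i\<in>{..n}. p i \<otimes>\<^bsub>A\<^esub> q (n - i))"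
  by (simp add: UP_def)

lemma poly_mult_closed: "p \<in> up A \<Longrightarrow> q \<in> up A \<Longrightarrow> p \<otimes>\<^bsub>UP A\<^esub> q \<in> up A"
proof -
  interpret U: UP_cring A "UP A" by (rule UP_cring_A)
  show "p \<in> up A \<Longrightarrow> q \<in> up A \<Longrightarrow> ?thesis" using U.P.m_closed by (simp add: UP_carrier)
qed

lemma UP_mult_monom_coeff:
  assumes "p \<in> up A" "a \<in> carrier A"
  shows "(p \<otimes>\<^bsub>UP A\<^esub> monom (UP A) a k) n = (if k \<le> n then p (n - k) \<otimes>\<^bsub>A\<^esub> a else \<zero>\<^bsub>A\<^esub>)"
proof -
  have c: "p i \<in> carrier A" for i using assms by auto
  have "(p \<otimes>\<^bsub>UP A\<^esub> monom (UP A) a k) n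
      = (\<Oplus>\<^bsub>A\<^esub>i\<in>{..n}. p i \<otimes>\<^bsub>A\<^esub> (if n - i = k then a else \<zero>\<^bsub>A\<^esub>))"
    using assms UP_monom_closed[of a k] by (simp add: UP_mult) (simp add: UP_monom)
  also have "\<dots> = (if k \<le> n then p (n - k) \<otimes>\<^bsub>A\<^esub> a else \<zero>\<^bsub>A\<^esub>)"
  proof (cases "k \<le> n")
    case True
    have "(\<Oplus>\<^bsub>A\<^esub>i\<in>{..n}. p i \<otimes>\<^bsub>A\<^esub> (if n - i = k then a else \<zero>\<^bsub>A\<^esub>))
      = (\<Oplus>\<^bsub>A\<^esub>i\<in>{..n}. if n - k = i then p i \<otimes>\<^bsub>A\<^esub> a else \<zero>\<^bsub>A\<^esub>)"
      using True c assms by (intro M.add.finprod_cong') auto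
    also have "\<dots> = p (n - k) \<otimes>\<^bsub>A\<^esub> a"
      using True c assms by (intro M.add.finprod_singleton) auto
    finally show ?thesis using True by simp
  next
    case False
    then have "(\<Oplus>\<^bsub>A\<^esub>i\<in>{..n}. p i \<otimes>\<^bsub>A\<^esub> (if n - i = k then a else \<zero>\<^bsub>A\<^esub>))
      = (\<Oplus>\<^bsub>A\<^esub>i\<in>{..n}. \<zero>\<^bsub>A\<^esub>)"
      using c by (intro M.add.finprod_cong') auto
    then show ?thesis using False by simp
  qed
  finally show ?thesis .
qed

lemma add_pow_smult:
  assumes "c \<in> carrier K" "x \<in> carrier A"
  shows "[(n::nat)] \<cdot>\<^bsub>A\<^esub> (c \<odot>\<^bsub>A\<^esub> x) = c \<odot>\<^bsub>A\<^esub> ([n] \<cdot>\<^bsub>A\<^esub> x)"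
  using assms by (induction n) (auto simp: smult_r_distr)

lemma bracket_add_pow_left:
  assumes "x \<in> carrier A" "y \<in> carrier A"
  shows "\<lbrace>[(n::nat)] \<cdot>\<^bsub>A\<^esub> x, y\<rbrace>\<^bsub>A\<^esub> = [n] \<cdot>\<^bsub>A\<^esub> \<lbrace>x, y\<rbrace>\<^bsub>A\<^esub>"
  using assms by (induction n) (auto simp: bracket_add_left bracket_zero_left)

lemma bracket_add_pow_right:
  assumes "x \<in> carrier A" "y \<in> carrier A"
  shows "\<lbrace>x, [(n::nat)] \<cdot>\<^bsub>A\<^esub> y\<rbrace>\<^bsub>A\<^esub> = [n] \<cdot>\<^bsub>A\<^esub> \<lbrace>x, y\<rbrace>\<^bsub>A\<^esub>"
  using assms by (induction n) (auto simp: bracket_add_right bracket_zero_right)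

lemma formal_deriv_closed:
  assumes "p \<in> up A" shows "formal_deriv A p \<in> up A"
proof -
  obtain n where "bound \<zero>\<^bsub>A\<^esub> n p" using assms by (auto simp: up_def)
  then have "bound \<zero>\<^bsub>A\<^esub> n (formal_deriv A p)" by (auto simp: bound_def formal_deriv_def)
  then show ?thesis using assms by (intro mem_upI) (auto simp: formal_deriv_def)
qed

theorem formal_deriv_poisson_derivation:
  "poisson_derivation K (poisson_poly A) (formal_deriv A)"
proof -
  have c: "p i \<in> carrier A" if "p \<in> up A" for p i using that by auto
  have add: "formal_deriv A (p \<oplus>\<^bsub>UP A\<^esub> q) = formal_deriv A p \<oplus>\<^bsub>UP A\<^esub> formal_deriv A q"
    if "p \<in> up A" "q \<in> up A" for p q
    using that c[OF that(1)] c[OF that(2)]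
    by (simp add: UP_add formal_deriv_closed)
      (auto simp: formal_deriv_def M.add.nat_pow_distrib simp del: M.add.nat_pow_Suc)
  have smult: "formal_deriv A (\<lambda>n. s \<odot>\<^bsub>A\<^esub> p n) = (\<lambda>n. s \<odot>\<^bsub>A\<^esub> formal_deriv A p n)"
    if "s \<in> carrier K" "p \<in> up A" for s p
    using that(1) c[OF that(2)]
    by (auto simp: formal_deriv_def add_pow_smult simp del: M.add.nat_pow_Suc)
  have mult: "formal_deriv A (p \<otimes>\<^bsub>UP A\<^esub> q)
      = formal_deriv A p \<otimes>\<^bsub>UP A\<^esub> q \<oplus>\<^bsub>UP A\<^esub> p \<otimes>\<^bsub>UP A\<^esub> formal_deriv A q"
    if p: "p \<in> up A" and q: "q \<in> up A" for p q
  proof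
    fix n
    show "formal_deriv A (p \<otimes>\<^bsub>UP A\<^esub> q) n
      = (formal_deriv A p \<otimes>\<^bsub>UP A\<^esub> q \<oplus>\<^bsub>UP A\<^esub> p \<otimes>\<^bsub>UP A\<^esub> formal_deriv A q) n"
      using M.formal_deriv_convolution[of p q "\<lambda>x y. x \<otimes>\<^bsub>A\<^esub> y" n] c[OF p] c[OF q] p q
      by (simp add: UP_add UP_mult poly_mult_closed formal_deriv_closed add_pow_ldistr
          add_pow_rdistr formal_deriv_def[of A "p \<otimes>\<^bsub>UP A\<^esub> q"] del: M.add.nat_pow_Suc)
  qed
  have bracket: "formal_deriv A (poly_bracket p q)
      = poly_bracket (formal_deriv A p) q \<oplus>\<^bsub>UP A\<^esub> poly_bracket p (formal_deriv A q)"
    if p: "p \<in> up A" and q: "q \<in> up A" for p q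
  proof
    fix n
    show "formal_deriv A (poly_bracket p q) n
      = (poly_bracket (formal_deriv A p) q \<oplus>\<^bsub>UP A\<^esub> poly_bracket p (formal_deriv A q)) n"
      using M.formal_deriv_convolution[of p q "\<lambda>x y. \<lbrace>x, y\<rbrace>\<^bsub>A\<^esub>" n] c[OF p] c[OF q] p q
      by (simp add: UP_add poly_bracket_closed formal_deriv_closed bracket_closed
          bracket_add_pow_left bracket_add_pow_right
          formal_deriv_def[of A "poly_bracket p q"]
          del: M.add.nat_pow_Suc M.finsum_Suc)
       (simp add: poisson_poly_sel del: M.add.nat_pow_Suc M.finsum_Suc)
  qed
  show ?thesis
    unfolding poisson_derivation_def derivation_def poisson_poly_sel(1-6) UP_carrier
    using add smult mult bracket by (auto simp: formal_deriv_closed)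
qed

lemma formal_deriv_locally_nilpotent: "locally_nilpotent (poisson_poly A) (formal_deriv A)"
  unfolding locally_nilpotent_def
proof
  fix p assume "p \<in> carrier (poisson_poly A)"
  then have p: "p \<in> up A" by (simp add: poisson_poly_sel UP_carrier)
  have *: "(formal_deriv A ^^ n) p = \<zero>\<^bsub>UP A\<^esub>" if "\<And>m. m \<ge> n \<Longrightarrow> p m = \<zero>\<^bsub>A\<^esub>" for n p
    using that
  proof (induction n arbitrary: p)
    case 0
    then show ?case by (auto simp: UP_zero)
  next
    case (Suc n)
    have "formal_deriv A p m = \<zero>\<^bsub>A\<^esub>" if "m \<ge> n" for m
      using Suc.prems[of "Suc m"] that by (simp add: formal_deriv_def)
    then show ?case using Suc.IH by (simp add: funpow_swap1 del: funpow.simps add: funpow_Suc_right)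
  qed
  obtain n where "bound \<zero>\<^bsub>A\<^esub> n p" using p by (auto simp: up_def)
  then have "\<And>m. m \<ge> Suc n \<Longrightarrow> p m = \<zero>\<^bsub>A\<^esub>" by (auto simp: bound_def)
  then show "\<exists>n. (formal_deriv A ^^ n) p = \<zero>\<^bsub>poisson_poly A\<^esub>"
    using *[of "Suc n" p] unfolding poisson_poly_sel by blast
qed

lemma formal_deriv_monom_0:
  "a \<in> carrier A \<Longrightarrow> formal_deriv A (monom (UP A) a 0) = \<zero>\<^bsub>UP A\<^esub>"
  by (auto simp: formal_deriv_def UP_monom UP_zero)

lemma formal_deriv_var: "formal_deriv A (monom (UP A) \<one>\<^bsub>A\<^esub> 1) = \<one>\<^bsub>UP A\<^esub>"
  by (auto simp: formal_deriv_def UP_monom UP_def)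

lemma formal_deriv_eq_zero_imp_const:
  assumes "field K" "char_zero K" "p \<in> up A" "formal_deriv A p = \<zero>\<^bsub>UP A\<^esub>"
  shows "p = monom (UP A) (p 0) 0"
proof
  fix n
  have c: "p i \<in> carrier A" for i using assms by auto
  show "p n = monom (UP A) (p 0) 0 n"
  proof (cases n)
    case (Suc m)
    have "[Suc m] \<cdot>\<^bsub>A\<^esub> p (Suc m) = \<zero>\<^bsub>A\<^esub>"
      using fun_cong[OF assms(4), of m] by (simp only: formal_deriv_def UP_zero)
    then have "p (Suc m) = \<zero>\<^bsub>A\<^esub>" using add_pow_torsion_free[OF assms(1,2) c] by blast
    then show ?thesis using c Suc by (simp add: UP_monom)
  qed (simp add: UP_monom c)
qed

section \<open>Derivations of a polynomial Poisson algebra\<close>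

lemma UP_monom_mult_var:
  assumes "a \<in> carrier A"
  shows "monom (UP A) a (Suc k) = monom (UP A) a k \<otimes>\<^bsub>UP A\<^esub> monom (UP A) \<one>\<^bsub>A\<^esub> 1"
proof -
  interpret U: UP_cring A "UP A" by (rule UP_cring_A)
  show ?thesis using U.monom_mult[of a "\<one>\<^bsub>A\<^esub>" k 1] assms by simp
qed

lemma UP_mult_comm: "p \<in> up A \<Longrightarrow> q \<in> up A \<Longrightarrow> p \<otimes>\<^bsub>UP A\<^esub> q = q \<otimes>\<^bsub>UP A\<^esub> p"
proof -
  interpret U: UP_cring A "UP A" by (rule UP_cring_A)
  show "p \<in> up A \<Longrightarrow> q \<in> up A \<Longrightarrow> ?thesis" using U.P.m_comm by (simp add: UP_carrier)
qed

lemma poly_bracket_monom_0_right: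
  assumes "p \<in> up A" "b \<in> carrier A"
  shows "poly_bracket p (monom (UP A) b 0) n = \<lbrace>p n, b\<rbrace>\<^bsub>A\<^esub>"
proof -
  have c: "p i \<in> carrier A" for i using assms by auto
  have "poly_bracket p (monom (UP A) b 0) n
      = (\<Oplus>\<^bsub>A\<^esub>i\<in>{..n}. if n = i then \<lbrace>p i, b\<rbrace>\<^bsub>A\<^esub> else \<zero>\<^bsub>A\<^esub>)"
    unfolding poisson_poly_sel using c assms
    by (intro M.add.finprod_cong') (auto simp: UP_monom bracket_zero_right bracket_closed)
  also have "\<dots> = \<lbrace>p n, b\<rbrace>\<^bsub>A\<^esub>"
    using c assms by (intro M.add.finprod_singleton) (auto simp: bracket_closed)
  finally show ?thesis .
qed

lemma poly_bracket_monom_0_left: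
  assumes "p \<in> up A" "b \<in> carrier A"
  shows "poly_bracket (monom (UP A) b 0) p n = \<lbrace>b, p n\<rbrace>\<^bsub>A\<^esub>"
proof -
  have c: "p i \<in> carrier A" for i using assms by auto
  have "poly_bracket (monom (UP A) b 0) p n
      = (\<Oplus>\<^bsub>A\<^esub>i\<in>{..n}. if 0 = i then \<lbrace>b, p (n - i)\<rbrace>\<^bsub>A\<^esub> else \<zero>\<^bsub>A\<^esub>)"
    unfolding poisson_poly_sel using c assms
    by (intro M.add.finprod_cong') (auto simp: UP_monom bracket_zero_left bracket_closed)
  also have "\<dots> = \<lbrace>b, p (n - 0)\<rbrace>\<^bsub>A\<^esub>"
    using c assms by (intro M.add.finprod_singleton) (auto simp: bracket_closed)
  finally show ?thesis by simp
qed

context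
  fixes D
  assumes der: "derivation K (poisson_poly A) D"
begin

lemma poly_derivation_rules:
  shows D_closed: "p \<in> up A \<Longrightarrow> D p \<in> up A"
    and D_coeff_closed: "p \<in> up A \<Longrightarrow> D p i \<in> carrier A"
    and D_add: "\<lbrakk>p \<in> up A; q \<in> up A\<rbrakk> \<Longrightarrow> D (p \<oplus>\<^bsub>UP A\<^esub> q) = D p \<oplus>\<^bsub>UP A\<^esub> D q"
    and D_smult: "\<lbrakk>c \<in> carrier K; p \<in> up A\<rbrakk> \<Longrightarrow> D (\<lambda>n. c \<odot>\<^bsub>A\<^esub> p n) = (\<lambda>n. c \<odot>\<^bsub>A\<^esub> D p n)"
    and D_mult: "\<lbrakk>p \<in> up A; q \<in> up A\<rbrakk>
      \<Longrightarrow> D (p \<otimes>\<^bsub>UP A\<^esub> q) = D p \<otimes>\<^bsub>UP A\<^esub> q \<oplus>\<^bsub>UP A\<^esub> p \<otimes>\<^bsub>UP A\<^esub> D q"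
proof -
  show cl: "D p \<in> up A" if "p \<in> up A" for p
    using der that unfolding derivation_def poisson_poly_sel(1-6) UP_carrier by auto
  show "D p i \<in> carrier A" if "p \<in> up A" using cl[OF that] by auto
  show "\<lbrakk>p \<in> up A; q \<in> up A\<rbrakk> \<Longrightarrow> D (p \<oplus>\<^bsub>UP A\<^esub> q) = D p \<oplus>\<^bsub>UP A\<^esub> D q"
    "\<lbrakk>c \<in> carrier K; p \<in> up A\<rbrakk> \<Longrightarrow> D (\<lambda>n. c \<odot>\<^bsub>A\<^esub> p n) = (\<lambda>n. c \<odot>\<^bsub>A\<^esub> D p n)"
    "\<lbrakk>p \<in> up A; q \<in> up A\<rbrakk>
      \<Longrightarrow> D (p \<otimes>\<^bsub>UP A\<^esub> q) = D p \<otimes>\<^bsub>UP A\<^esub> q \<oplus>\<^bsub>UP A\<^esub> p \<otimes>\<^bsub>UP A\<^esub> D q"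
    using der unfolding derivation_def poisson_poly_sel(1-6) UP_carrier by auto
qed

lemma D_mult_coeff:
  assumes "p \<in> up A" "a \<in> carrier A"
  shows "D (p \<otimes>\<^bsub>UP A\<^esub> monom (UP A) a k) n
    = (if k \<le> n then D p (n - k) \<otimes>\<^bsub>A\<^esub> a else \<zero>\<^bsub>A\<^esub>) \<oplus>\<^bsub>A\<^esub> (D (monom (UP A) a k) \<otimes>\<^bsub>UP A\<^esub> p) n"
  using assms UP_monom_closed[OF assms(2), of k]
  by (simp add: D_mult UP_add poly_mult_closed D_closed UP_mult_monom_coeff UP_mult_comm)

lemma D_const_mult:
  assumes "a \<in> carrier A" "b \<in> carrier A"
  shows "D (monom (UP A) (a \<otimes>\<^bsub>A\<^esub> b) 0) n
    = D (monom (UP A) a 0) n \<otimes>\<^bsub>A\<^esub> b \<oplus>\<^bsub>A\<^esub> a \<otimes>\<^bsub>A\<^esub> D (monom (UP A) b 0) n"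
proof -
  interpret U: UP_cring A "UP A" by (rule UP_cring_A)
  have "monom (UP A) (a \<otimes>\<^bsub>A\<^esub> b) 0 = monom (UP A) a 0 \<otimes>\<^bsub>UP A\<^esub> monom (UP A) b 0"
    using U.monom_mult[of a b 0 0] assms by simp
  then show ?thesis using assms
    by (simp add: D_mult_coeff UP_monom_closed UP_mult_monom_coeff D_closed D_coeff_closed m_comm)
qed

lemma D_const_add:
  assumes "a \<in> carrier A" "b \<in> carrier A"
  shows "D (monom (UP A) (a \<oplus>\<^bsub>A\<^esub> b) 0) n
    = D (monom (UP A) a 0) n \<oplus>\<^bsub>A\<^esub> D (monom (UP A) b 0) n"
proof -
  interpret U: UP_cring A "UP A" by (rule UP_cring_A)
  show ?thesis
    unfolding U.monom_add[OF assms] D_add[OF UP_monom_closed UP_monom_closed, OF assms]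
    using assms by (subst UP_add) (simp_all add: D_closed UP_monom_closed)
qed

lemma D_const_smult:
  assumes "c \<in> carrier K" "a \<in> carrier A"
  shows "D (monom (UP A) (c \<odot>\<^bsub>A\<^esub> a) 0) n = c \<odot>\<^bsub>A\<^esub> D (monom (UP A) a 0) n"
proof -
  have "monom (UP A) (c \<odot>\<^bsub>A\<^esub> a) 0 = (\<lambda>n. c \<odot>\<^bsub>A\<^esub> monom (UP A) a 0 n)"
    using assms by (auto simp: UP_monom)
  then show ?thesis using assms by (simp add: D_smult UP_monom_closed)
qed

lemma D_const_one: "D (monom (UP A) \<one>\<^bsub>A\<^esub> 0) n = \<zero>\<^bsub>A\<^esub>"
proof -
  have c: "D (monom (UP A) \<one>\<^bsub>A\<^esub> 0) n \<in> carrier A" by (simp add: D_coeff_closed UP_monom_closed)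
  then show ?thesis using D_const_mult[of "\<one>\<^bsub>A\<^esub>" "\<one>\<^bsub>A\<^esub>" n] by (simp add: M.add.l_cancel_one')
qed

text \<open>
  Stated on constants and on the variable, from which every polynomial inherits it.  The variable
  has degree one, hence the bound \<open>Suc d\<close>.
\<close>

definition raises_degree_at_most :: "nat \<Rightarrow> bool" where
  "raises_degree_at_most d \<longleftrightarrow> (\<forall>a\<in>carrier A. \<forall>m>d. D (monom (UP A) a 0) m = \<zero>\<^bsub>A\<^esub>)
     \<and> (\<forall>m>Suc d. D (monom (UP A) \<one>\<^bsub>A\<^esub> 1) m = \<zero>\<^bsub>A\<^esub>)"

text \<open>
  The constants on which a given bound holds form a \<open>K\<close>-subalgebra of \<open>A\<close>, so it suffices to bound
  the degree of \<open>D\<close> on finitely many generators.  This is where finite generation is needed.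
\<close>

lemma ex_degree_bound:
  assumes "finitely_generated_algebra K A"
  shows "\<exists>d. raises_degree_at_most d"
proof -
  obtain S where S: "finite S" "S \<subseteq> carrier A"
    "carrier A = generate_ring A ((\<lambda>c. c \<odot>\<^bsub>A\<^esub> \<one>\<^bsub>A\<^esub>) ` carrier K \<union> S)"
    using assms by (auto simp: finitely_generated_algebra_def)
  have ex: "\<exists>n. \<forall>m>n. D p m = \<zero>\<^bsub>A\<^esub>" if "p \<in> up A" for p
    using D_closed[OF that] by (auto simp: up_def bound_def)
  then obtain N where N: "\<And>p m. p \<in> up A \<Longrightarrow> m > N p \<Longrightarrow> D p m = \<zero>\<^bsub>A\<^esub>" by metis
  define d where "d = Max (insert (N (monom (UP A) \<one>\<^bsub>A\<^esub> 1)) ((\<lambda>s. N (monom (UP A) s 0)) ` S))"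
  have dX: "N (monom (UP A) \<one>\<^bsub>A\<^esub> 1) \<le> d" and dS: "\<And>s. s \<in> S \<Longrightarrow> N (monom (UP A) s 0) \<le> d"
    using S(1) by (auto simp: d_def)
  have gen: "a \<in> carrier A \<and> (\<forall>m>d. D (monom (UP A) a 0) m = \<zero>\<^bsub>A\<^esub>)"
    if "a \<in> generate_ring A ((\<lambda>c. c \<odot>\<^bsub>A\<^esub> \<one>\<^bsub>A\<^esub>) ` carrier K \<union> S)" for a
    using that
  proof induction
    case one
    then show ?case by (simp add: D_const_one)
  next
    case (incl h)
    then show ?case
    proof
      assume "h \<in> (\<lambda>c. c \<odot>\<^bsub>A\<^esub> \<one>\<^bsub>A\<^esub>) ` carrier K"
      then show ?thesis by (auto simp: D_const_smult D_const_one)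
    next
      assume h: "h \<in> S"
      then have "D (monom (UP A) h 0) m = \<zero>\<^bsub>A\<^esub>" if "m > d" for m
        using that dS[OF h] S(2) by (intro N UP_monom_closed) auto
      then show ?thesis using h S(2) by auto
    qed
  next
    case (a_inv h)
    have "D (monom (UP A) (\<ominus>\<^bsub>A\<^esub> h) 0) m = \<zero>\<^bsub>A\<^esub>" if "m > d" for m
    proof -
      have "D (monom (UP A) (h \<oplus>\<^bsub>A\<^esub> \<ominus>\<^bsub>A\<^esub> h) 0) m = \<zero>\<^bsub>A\<^esub>"
        using a_inv D_const_smult[of "\<zero>\<^bsub>K\<^esub>" "\<zero>\<^bsub>A\<^esub>" m]
        by (simp add: M.r_neg D_coeff_closed UP_monom_closed)
      then show ?thesis
        using a_inv that by (simp add: D_const_add D_coeff_closed UP_monom_closed del: M.r_neg)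
    qed
    then show ?case using a_inv by simp
  next
    case (eng_add h1 h2)
    then show ?case by (simp add: D_const_add)
  next
    case (eng_mult h1 h2)
    then show ?case by (simp add: D_const_mult)
  qed
  have "D (monom (UP A) \<one>\<^bsub>A\<^esub> 1) m = \<zero>\<^bsub>A\<^esub>" if "m > Suc d" for m
    using that dX by (intro N UP_monom_closed) auto
  moreover have "\<forall>a\<in>carrier A. \<forall>m>d. D (monom (UP A) a 0) m = \<zero>\<^bsub>A\<^esub>"
    using gen S(3) by blast
  ultimately show ?thesis unfolding raises_degree_at_most_def by blast
qed

text \<open>
  With \<open>\<delta> a\<close> the coefficient of \<open>t^d\<close> in \<open>D a\<close> and \<open>f\<close> that of \<open>t^(d + 1)\<close> in \<open>D t\<close>, the derivation
  that \<open>D\<close> induces in degree \<open>d\<close> on the associated graded algebra sends \<open>a t^k\<close> to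
  \<open>(\<delta> a + k f a) t^(k + d)\<close>.
\<close>

definition leading_part :: "nat \<Rightarrow> nat \<Rightarrow> 'a \<Rightarrow> 'a" where
  "leading_part d k a = D (monom (UP A) a 0) d
     \<oplus>\<^bsub>A\<^esub> [k] \<cdot>\<^bsub>A\<^esub> (D (monom (UP A) \<one>\<^bsub>A\<^esub> 1) (Suc d) \<otimes>\<^bsub>A\<^esub> a)"

lemma leading_part_closed: "a \<in> carrier A \<Longrightarrow> leading_part d k a \<in> carrier A"
  by (simp add: leading_part_def D_coeff_closed UP_monom_closed)

context
  fixes d
  assumes deg: "raises_degree_at_most d"
begin

lemma D_monom_top:
  assumes a: "a \<in> carrier A"
  shows "D (monom (UP A) a k) (k + d) = leading_part d k a
    \<and> (\<forall>j>k + d. D (monom (UP A) a k) j = \<zero>\<^bsub>A\<^esub>)"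
proof (induction k)
  case 0
  then show ?case using deg a
    by (auto simp: leading_part_def raises_degree_at_most_def D_coeff_closed UP_monom_closed)
next
  case (Suc k)
  let ?X = "monom (UP A) \<one>\<^bsub>A\<^esub> 1"
  have c: "D ?X i \<in> carrier A" "D (monom (UP A) a k) i \<in> carrier A"
     "D (monom (UP A) a 0) i \<in> carrier A" for i
    using a by (auto intro!: D_coeff_closed UP_monom_closed)
  have *: "D (monom (UP A) a (Suc k)) j = D (monom (UP A) a k) (j - 1) \<oplus>\<^bsub>A\<^esub> D ?X (j - k) \<otimes>\<^bsub>A\<^esub> a"
    if "j \<ge> Suc k" for j
    unfolding UP_monom_mult_var[OF a] using a that c
    by (simp add: D_mult_coeff UP_monom_closed UP_mult_monom_coeff D_closed)
  show ?case
  proof (intro conjI allI impI)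
    have "D (monom (UP A) a (Suc k)) (Suc k + d)
      = leading_part d k a \<oplus>\<^bsub>A\<^esub> D ?X (Suc d) \<otimes>\<^bsub>A\<^esub> a"
      using *[of "Suc k + d"] Suc by (simp add: Suc_diff_le)
    also have "\<dots> = leading_part d (Suc k) a"
      using a c by (simp add: leading_part_def M.a_assoc)
    finally show "D (monom (UP A) a (Suc k)) (Suc k + d) = leading_part d (Suc k) a" .
  next
    fix j assume j: "j > Suc k + d"
    then have "D (monom (UP A) a k) (j - 1) = \<zero>\<^bsub>A\<^esub>" using Suc by auto
    moreover have "D ?X (j - k) = \<zero>\<^bsub>A\<^esub>" using deg j by (auto simp: raises_degree_at_most_def)
    ultimately show "D (monom (UP A) a (Suc k)) j = \<zero>\<^bsub>A\<^esub>" using j a by (simp add: *)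
  qed
qed

lemma D_top:
  assumes "p \<in> up A" "\<forall>j>k. p j = \<zero>\<^bsub>A\<^esub>"
  shows "D p (k + d) = leading_part d k (p k) \<and> (\<forall>j>k + d. D p j = \<zero>\<^bsub>A\<^esub>)"
  using assms
proof (induction k arbitrary: p)
  case 0
  have "p = monom (UP A) (p 0) 0" using 0 by (auto simp: UP_monom mem_upD)
  then show ?case using D_monom_top[of "p 0" 0] 0 by (metis mem_upD)
next
  case (Suc k)
  define q where "q = p(Suc k := \<zero>\<^bsub>A\<^esub>)"
  have pc: "p i \<in> carrier A" for i using Suc.prems(1) by auto
  have q0: "\<forall>j>k. q j = \<zero>\<^bsub>A\<^esub>" using Suc.prems(2) by (auto simp: q_def)
  have q: "q \<in> up A"
    using pc q0 by (intro mem_upI) (auto simp: q_def bound_def intro!: exI[of _ k])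
  have "p = q \<oplus>\<^bsub>UP A\<^esub> monom (UP A) (p (Suc k)) (Suc k)"
    unfolding UP_add[OF q UP_monom_closed[OF pc]] using pc by (auto simp: UP_monom q_def)
  then have Dp: "D p j = D q j \<oplus>\<^bsub>A\<^esub> D (monom (UP A) (p (Suc k)) (Suc k)) j" for j
    using D_add[OF q UP_monom_closed[OF pc]] q pc
    by (metis UP_add D_closed UP_monom_closed)
  show ?case using Suc.IH[OF q q0] D_monom_top[OF pc, of "Suc k" "Suc k"] pc
    by (auto simp: Dp D_coeff_closed UP_monom_closed leading_part_closed)
qed

lemma leading_part_graded_derivation: "graded_derivation A (leading_part d)"
proof (intro graded_derivation.intro graded_derivation_axioms.intro)
  show "cring A" by (rule M_cring)
  have c: "D (monom (UP A) \<one>\<^bsub>A\<^esub> 1) i \<in> carrier A" for i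
    by (auto intro!: D_coeff_closed UP_monom_closed)
  have c': "D (monom (UP A) a 0) i \<in> carrier A" if "a \<in> carrier A" for i a
    using that by (auto intro!: D_coeff_closed UP_monom_closed)
  fix a k assume a: "a \<in> carrier A"
  show "leading_part d k a \<in> carrier A" using a by (rule leading_part_closed)
  fix b assume b: "b \<in> carrier A"
  show "leading_part d k (a \<oplus>\<^bsub>A\<^esub> b) = leading_part d k a \<oplus>\<^bsub>A\<^esub> leading_part d k b"
    using a b c c'
    by (simp add: leading_part_def D_const_add r_distr M.add.nat_pow_distrib M.a_ac)
  fix l
  let ?f = "D (monom (UP A) \<one>\<^bsub>A\<^esub> 1) (Suc d)"
  have "[(k + l)] \<cdot>\<^bsub>A\<^esub> (?f \<otimes>\<^bsub>A\<^esub> (a \<otimes>\<^bsub>A\<^esub> b))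
     = ([k] \<cdot>\<^bsub>A\<^esub> (?f \<otimes>\<^bsub>A\<^esub> a)) \<otimes>\<^bsub>A\<^esub> b \<oplus>\<^bsub>A\<^esub> a \<otimes>\<^bsub>A\<^esub> ([l] \<cdot>\<^bsub>A\<^esub> (?f \<otimes>\<^bsub>A\<^esub> b))"
    using a b c by (simp add: add_pow_ldistr add_pow_rdistr m_ac flip: M.add.nat_pow_mult)
  then show "leading_part d (k + l) (a \<otimes>\<^bsub>A\<^esub> b)
     = leading_part d k a \<otimes>\<^bsub>A\<^esub> b \<oplus>\<^bsub>A\<^esub> a \<otimes>\<^bsub>A\<^esub> leading_part d l b"
    using a b c c' by (simp add: leading_part_def D_const_mult l_distr r_distr M.a_ac)
qed

text \<open>
  Coefficients in the top admissible degree see only the induced graded derivation, also after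
  iteration; thus the latter is locally nilpotent as soon as \<open>D\<close> is.
\<close>

lemma funpow_D_top:
  assumes "p \<in> up A" "\<forall>j>k. p j = \<zero>\<^bsub>A\<^esub>"
  shows "(D ^^ n) p (k + n * d) = graded_derivation.iter (leading_part d) d n k (p k)"
  using assms
proof (induction n arbitrary: p k)
  case 0
  interpret graded_derivation A "leading_part d" d by (rule leading_part_graded_derivation)
  show ?case by simp
next
  case (Suc n)
  interpret graded_derivation A "leading_part d" d by (rule leading_part_graded_derivation)
  have "(D ^^ Suc n) p (k + Suc n * d) = (D ^^ n) (D p) ((k + d) + n * d)"
    by (simp add: funpow_swap1 add_ac)
  also have "\<dots> = iter n (k + d) (D p (k + d))"
    using D_top[OF Suc.prems] D_closed[OF Suc.prems(1)] by (intro Suc.IH) auto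
  finally show ?case using D_top[OF Suc.prems] by simp
qed

lemma leading_part_nilpotent:
  assumes "locally_nilpotent (poisson_poly A) D" "a \<in> carrier A"
  shows "\<exists>n. graded_derivation.iter (leading_part d) d n k a = \<zero>\<^bsub>A\<^esub>"
proof -
  have m: "monom (UP A) a k \<in> up A" using assms by (simp add: UP_monom_closed)
  then obtain n where "(D ^^ n) (monom (UP A) a k) = \<zero>\<^bsub>UP A\<^esub>"
    using assms(1) by (auto simp: locally_nilpotent_def poisson_poly_sel UP_carrier)
  then show ?thesis using funpow_D_top[OF m, of k n] assms(2)
    by (auto simp: UP_monom UP_zero intro!: exI[of _ n])
qed

text \<open>
  The induced graded derivation sends \<open>t\<close> to \<open>f t^(d + 1)\<close>, a multiple of \<open>t\<close>, so \<open>f = 0\<close> by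
  \<open>not_own_divisor\<close>.  It then acts on coefficients by \<open>\<delta>\<close> in every degree, so \<open>\<delta>\<close> is locally
  nilpotent; it is a Poisson derivation because the bracket of a constant with a polynomial is taken
  coefficientwise.  Rigidity of \<open>A\<close> forces \<open>\<delta> = 0\<close>.
\<close>

lemma rigid_imp_top_coeffs_zero:
  assumes K: "field K" "char_zero K" and dom: "domain A"
    and pd: "poisson_derivation K (poisson_poly A) D"
    and nil: "locally_nilpotent (poisson_poly A) D"
    and rigid: "\<not> (\<exists>d. poisson_derivation K A d \<and> locally_nilpotent A d \<and> nontrivial_map A d)"
  shows "D (monom (UP A) \<one>\<^bsub>A\<^esub> 1) (Suc d) = \<zero>\<^bsub>A\<^esub>"
    and "a \<in> carrier A \<Longrightarrow> D (monom (UP A) a 0) d = \<zero>\<^bsub>A\<^esub>"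
proof -
  interpret G: graded_derivation A "leading_part d" d by (rule leading_part_graded_derivation)
  interpret dom: "domain" A by (rule dom)
  let ?f = "D (monom (UP A) \<one>\<^bsub>A\<^esub> 1) (Suc d)"
  let ?\<delta> = "\<lambda>a. D (monom (UP A) a 0) d"
  have f: "?f \<in> carrier A" by (auto intro!: D_coeff_closed UP_monom_closed)
  have \<delta>c: "?\<delta> a \<in> carrier A" if "a \<in> carrier A" for a
    using that by (auto intro!: D_coeff_closed UP_monom_closed)
  have "\<one>\<^bsub>A\<^esub> = \<zero>\<^bsub>A\<^esub> \<or> ?f = \<zero>\<^bsub>A\<^esub>"
  proof (rule G.not_own_divisor)
    show "leading_part d 1 \<one>\<^bsub>A\<^esub> = \<one>\<^bsub>A\<^esub> \<otimes>\<^bsub>A\<^esub> ?f"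
      using f by (simp add: leading_part_def D_const_one)
  qed (use f dom.integral add_pow_torsion_free[OF K] leading_part_nilpotent[OF nil] in auto)
  then show f0: "?f = \<zero>\<^bsub>A\<^esub>" by simp
  have lp: "leading_part d k a = ?\<delta> a" if "a \<in> carrier A" for k a
    using that f0 by (simp add: leading_part_def \<delta>c)
  have iter: "G.iter n k a = (?\<delta> ^^ n) a" if "a \<in> carrier A" for n k a
    using that by (induction n arbitrary: k a) (auto simp: lp \<delta>c funpow_Suc_right simp del: funpow.simps(2))
  have "locally_nilpotent A ?\<delta>"
    using leading_part_nilpotent[OF nil, of _ 0] by (auto simp: locally_nilpotent_def iter)
  moreover have "poisson_derivation K A ?\<delta>"
    unfolding poisson_derivation_def derivation_def
  proof (intro conjI ballI)
    show "?\<delta> \<in> carrier A \<rightarrow> carrier A" using \<delta>c by auto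
    fix x y assume xy: "x \<in> carrier A" "y \<in> carrier A"
    show "?\<delta> (x \<oplus>\<^bsub>A\<^esub> y) = ?\<delta> x \<oplus>\<^bsub>A\<^esub> ?\<delta> y" using xy by (rule D_const_add)
    show "?\<delta> (x \<otimes>\<^bsub>A\<^esub> y) = ?\<delta> x \<otimes>\<^bsub>A\<^esub> y \<oplus>\<^bsub>A\<^esub> x \<otimes>\<^bsub>A\<^esub> ?\<delta> y" using xy by (rule D_const_mult)
    let ?x = "monom (UP A) x 0" and ?y = "monom (UP A) y 0"
    have m: "?x \<in> up A" "?y \<in> up A" using xy by (auto intro: UP_monom_closed)
    have "D (poly_bracket ?x ?y) = poly_bracket (D ?x) ?y \<oplus>\<^bsub>UP A\<^esub> poly_bracket ?x (D ?y)"
      using pd m unfolding poisson_derivation_def poisson_poly_sel(1-6) UP_carrier by blast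
    then show "?\<delta> \<lbrace>x, y\<rbrace>\<^bsub>A\<^esub> = \<lbrace>?\<delta> x, y\<rbrace>\<^bsub>A\<^esub> \<oplus>\<^bsub>A\<^esub> \<lbrace>x, ?\<delta> y\<rbrace>\<^bsub>A\<^esub>"
      using xy m by (simp add: poly_bracket_const UP_add poly_bracket_closed D_closed
          poly_bracket_monom_0_left poly_bracket_monom_0_right)
  next
    fix c x assume "c \<in> carrier K" "x \<in> carrier A"
    then show "?\<delta> (c \<odot>\<^bsub>A\<^esub> x) = c \<odot>\<^bsub>A\<^esub> ?\<delta> x" by (rule D_const_smult)
  qed
  ultimately have "\<not> nontrivial_map A ?\<delta>" using rigid by blast
  then show "a \<in> carrier A \<Longrightarrow> ?\<delta> a = \<zero>\<^bsub>A\<^esub>" by (auto simp: nontrivial_map_def)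
qed

end

text \<open>
  Vanishing of both top coefficients lowers the degree bound by one.  Descent reaches \<open>d = 0\<close>, where
  the coefficient of \<open>D a\<close> in degree zero was its only possibly nonzero one.
\<close>

lemma rigid_imp_constants_in_kernel:
  assumes K: "field K" "char_zero K" and dom: "domain A"
    and fg: "finitely_generated_algebra K A"
    and pd: "poisson_derivation K (poisson_poly A) D"
    and nil: "locally_nilpotent (poisson_poly A) D"
    and rigid: "\<not> (\<exists>d. poisson_derivation K A d \<and> locally_nilpotent A d \<and> nontrivial_map A d)"
    and a: "a \<in> carrier A"
  shows "D (monom (UP A) a 0) = \<zero>\<^bsub>UP A\<^esub>"
proof -
  note vanish = rigid_imp_top_coeffs_zero[OF _ K dom pd nil rigid]
  have "\<forall>m. D (monom (UP A) a 0) m = \<zero>\<^bsub>A\<^esub>" if "raises_degree_at_most d" for d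
    using that
  proof (induction d)
    case 0
    then have "D (monom (UP A) a 0) m = \<zero>\<^bsub>A\<^esub>" for m
      using vanish(2)[OF 0 a] a by (cases "m = 0") (auto simp: raises_degree_at_most_def)
    then show ?case by blast
  next
    case (Suc d)
    have "raises_degree_at_most d"
      unfolding raises_degree_at_most_def
    proof (intro conjI ballI allI impI)
      fix b m assume "b \<in> carrier A" "m > d"
      then show "D (monom (UP A) b 0) m = \<zero>\<^bsub>A\<^esub>"
        using vanish(2)[OF Suc.prems, of b] Suc.prems
        by (cases "m = Suc d") (auto simp: raises_degree_at_most_def)
    next
      fix m assume "m > Suc d"
      then show "D (monom (UP A) \<one>\<^bsub>A\<^esub> 1) m = \<zero>\<^bsub>A\<^esub>"
        using vanish(1)[OF Suc.prems] Suc.prems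
        by (cases "m = Suc (Suc d)") (auto simp: raises_degree_at_most_def)
    qed
    then show ?case by (rule Suc.IH)
  qed
  then show ?thesis using ex_degree_bound[OF fg] by (auto simp: UP_zero)
qed

lemma multiple_of_formal_deriv:
  assumes const: "\<And>a. a \<in> carrier A \<Longrightarrow> D (monom (UP A) a 0) = \<zero>\<^bsub>UP A\<^esub>"
    and p: "p \<in> up A"
  shows "D p = formal_deriv A p \<otimes>\<^bsub>UP A\<^esub> D (monom (UP A) \<one>\<^bsub>A\<^esub> 1)"
proof -
  interpret U: UP_cring A "UP A" by (rule UP_cring_A)
  let ?X = "monom (UP A) \<one>\<^bsub>A\<^esub> 1"
  note [simp] = UP_carrier UP_monom_closed D_closed formal_deriv_closed poly_mult_closed
  have X: "D ?X \<in> up A" by simp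
  have fd_add: "formal_deriv A (p \<oplus>\<^bsub>UP A\<^esub> q) = formal_deriv A p \<oplus>\<^bsub>UP A\<^esub> formal_deriv A q"
    and fd_mult: "formal_deriv A (p \<otimes>\<^bsub>UP A\<^esub> q)
      = formal_deriv A p \<otimes>\<^bsub>UP A\<^esub> q \<oplus>\<^bsub>UP A\<^esub> p \<otimes>\<^bsub>UP A\<^esub> formal_deriv A q"
    if "p \<in> up A" "q \<in> up A" for p q
    using formal_deriv_poisson_derivation that
    unfolding poisson_derivation_def derivation_def poisson_poly_sel(1-6) UP_carrier by blast+
  show ?thesis
    using p
  proof (induction p rule: UP_monom_induct)
    case (1 a n)
    then show ?case
    proof (induction n)
      case 0
      then show ?case using U.P.l_null[of "D ?X"] by (simp add: const formal_deriv_monom_0)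
    next
      case (Suc n)
      let ?m = "monom (UP A) a n"
      have m: "?m \<in> carrier (UP A)" "?X \<in> carrier (UP A)" "D ?X \<in> carrier (UP A)"
          "formal_deriv A ?m \<in> carrier (UP A)" using Suc.prems by auto
      have "D (monom (UP A) a (Suc n)) = D ?m \<otimes>\<^bsub>UP A\<^esub> ?X \<oplus>\<^bsub>UP A\<^esub> ?m \<otimes>\<^bsub>UP A\<^esub> D ?X"
        unfolding UP_monom_mult_var[OF Suc.prems] using m by (intro D_mult) simp_all
      also have "\<dots> = (formal_deriv A ?m \<otimes>\<^bsub>UP A\<^esub> ?X \<oplus>\<^bsub>UP A\<^esub> ?m \<otimes>\<^bsub>UP A\<^esub> formal_deriv A ?X)
          \<otimes>\<^bsub>UP A\<^esub> D ?X"
        unfolding Suc.IH[OF Suc.prems] formal_deriv_var U.P.r_one[OF m(1)]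
          U.P.l_distr[OF U.P.m_closed[OF m(4,2)] m(1,3)]
          U.P.m_assoc[OF m(4,3,2)] U.P.m_assoc[OF m(4,2,3)] U.P.m_comm[OF m(3,2)] ..
      also have "\<dots> = formal_deriv A (monom (UP A) a (Suc n)) \<otimes>\<^bsub>UP A\<^esub> D ?X"
        unfolding UP_monom_mult_var[OF Suc.prems]
        using m fd_mult[of ?m ?X] by (simp only: UP_carrier)
      finally show ?case .
    qed
  next
    case (2 p q)
    then show ?case
      using U.P.l_distr[of "formal_deriv A p" "formal_deriv A q" "D ?X"]
      by (simp add: D_add fd_add)
  qed
qed

end

text \<open>
  A derivation killing the constants is \<open>p \<mapsto> p' D t\<close>.  When it is nonzero, so is \<open>D t\<close>, and in a
  domain of characteristic zero \<open>p' D t = 0\<close> leaves only constant \<open>p\<close>.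
\<close>

lemma kernel_eq_constants:
  assumes K: "field K" "char_zero K" and dom: "domain A"
    and der: "derivation K (poisson_poly A) D"
    and const: "\<And>a. a \<in> carrier A \<Longrightarrow> D (monom (UP A) a 0) = \<zero>\<^bsub>UP A\<^esub>"
    and nz: "q \<in> up A" "D q \<noteq> \<zero>\<^bsub>UP A\<^esub>"
    and p: "p \<in> up A" "D p = \<zero>\<^bsub>UP A\<^esub>"
  shows "p = monom (UP A) (p 0) 0"
proof -
  interpret V: UP_domain A "UP A" using dom by (simp add: UP_domain_def)
  let ?X = "monom (UP A) \<one>\<^bsub>A\<^esub> 1"
  have X: "D ?X \<in> up A" by (intro D_closed[OF der] UP_monom_closed) simp
  have "D ?X \<noteq> \<zero>\<^bsub>UP A\<^esub>"
    using multiple_of_formal_deriv[OF der const nz(1)] nz formal_deriv_closed[OF nz(1)] V.P.r_null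
    by (auto simp: UP_carrier)
  moreover have "formal_deriv A p \<otimes>\<^bsub>UP A\<^esub> D ?X = \<zero>\<^bsub>UP A\<^esub>"
    using multiple_of_formal_deriv[OF der const p(1)] p(2) by simp
  ultimately have "formal_deriv A p = \<zero>\<^bsub>UP A\<^esub>"
    using V.UP_integral[of "formal_deriv A p" "D ?X"] X formal_deriv_closed[OF p(1)]
    by (auto simp: UP_carrier)
  then show ?thesis using formal_deriv_eq_zero_imp_const[OF K p(1)] by simp
qed

end

section \<open>Transport along Poisson isomorphisms\<close>

locale poisson_isomorphism = R: poisson_algebra K R + S: poisson_algebra K S
  for K (structure) and R :: "('k, 'a, 'm) poisson_ring_scheme"
    and S :: "('k, 'b, 'n) poisson_ring_scheme" +
  fixes \<phi> :: "'a \<Rightarrow> 'b"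
  assumes iso: "\<phi> \<in> poisson_iso K R S"
begin

lemma hom:
  shows closed: "x \<in> carrier R \<Longrightarrow> \<phi> x \<in> carrier S"
    and mult: "\<lbrakk>x \<in> carrier R; y \<in> carrier R\<rbrakk> \<Longrightarrow> \<phi> (x \<otimes>\<^bsub>R\<^esub> y) = \<phi> x \<otimes>\<^bsub>S\<^esub> \<phi> y"
    and add: "\<lbrakk>x \<in> carrier R; y \<in> carrier R\<rbrakk> \<Longrightarrow> \<phi> (x \<oplus>\<^bsub>R\<^esub> y) = \<phi> x \<oplus>\<^bsub>S\<^esub> \<phi> y"
    and one: "\<phi> \<one>\<^bsub>R\<^esub> = \<one>\<^bsub>S\<^esub>"
    and bij: "bij_betw \<phi> (carrier R) (carrier S)"
    and smult: "\<lbrakk>c \<in> carrier K; x \<in> carrier R\<rbrakk> \<Longrightarrow> \<phi> (c \<odot>\<^bsub>R\<^esub> x) = c \<odot>\<^bsub>S\<^esub> \<phi> x"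
    and bracket: "\<lbrakk>x \<in> carrier R; y \<in> carrier R\<rbrakk> \<Longrightarrow> \<phi> \<lbrace>x, y\<rbrace>\<^bsub>R\<^esub> = \<lbrace>\<phi> x, \<phi> y\<rbrace>\<^bsub>S\<^esub>"
  using iso ring_iso_memE[of \<phi> R S] unfolding poisson_iso_def by auto

lemma zero: "\<phi> \<zero>\<^bsub>R\<^esub> = \<zero>\<^bsub>S\<^esub>"
  using smult[OF R.R.zero_closed R.M.zero_closed] closed[OF R.M.zero_closed] by simp

lemma eqI: "\<lbrakk>x \<in> carrier R; y \<in> carrier R; \<phi> x = \<phi> y\<rbrakk> \<Longrightarrow> x = y"
  using bij by (auto simp: bij_betw_def inj_on_def)

definition pullback :: "('b \<Rightarrow> 'b) \<Rightarrow> 'a \<Rightarrow> 'a" where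
  "pullback D x = inv_into (carrier R) \<phi> (D (\<phi> x))"

context
  fixes D
  assumes D: "poisson_derivation K S D"
begin

lemma pullback_closed: "x \<in> carrier R \<Longrightarrow> pullback D x \<in> carrier R"
  and pullback_image: "x \<in> carrier R \<Longrightarrow> \<phi> (pullback D x) = D (\<phi> x)"
proof -
  assume "x \<in> carrier R"
  then have "D (\<phi> x) \<in> \<phi> ` carrier R"
    using D closed bij by (auto simp: poisson_derivation_def derivation_def bij_betw_def)
  then show "pullback D x \<in> carrier R" "\<phi> (pullback D x) = D (\<phi> x)"
    by (auto simp: pullback_def inv_into_into f_inv_into_f)
qed

lemma pullback_poisson_derivation: "poisson_derivation K R (pullback D)"
  unfolding poisson_derivation_def derivation_def
proof (intro conjI ballI)
  note rules = D[unfolded poisson_derivation_def derivation_def]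
  show "pullback D \<in> carrier R \<rightarrow> carrier R" using pullback_closed by auto
  fix x y assume "x \<in> carrier R" "y \<in> carrier R"
  then show "pullback D (x \<oplus>\<^bsub>R\<^esub> y) = pullback D x \<oplus>\<^bsub>R\<^esub> pullback D y"
    "pullback D (x \<otimes>\<^bsub>R\<^esub> y) = pullback D x \<otimes>\<^bsub>R\<^esub> y \<oplus>\<^bsub>R\<^esub> x \<otimes>\<^bsub>R\<^esub> pullback D y"
    "pullback D \<lbrace>x, y\<rbrace>\<^bsub>R\<^esub> = \<lbrace>pullback D x, y\<rbrace>\<^bsub>R\<^esub> \<oplus>\<^bsub>R\<^esub> \<lbrace>x, pullback D y\<rbrace>\<^bsub>R\<^esub>"
    using rules by (auto intro!: eqI
      simp: pullback_closed pullback_image closed add mult bracket R.bracket_closed)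
next
  note rules = D[unfolded poisson_derivation_def derivation_def]
  fix c x assume "c \<in> carrier K" "x \<in> carrier R"
  then show "pullback D (c \<odot>\<^bsub>R\<^esub> x) = c \<odot>\<^bsub>R\<^esub> pullback D x"
    using rules by (auto intro!: eqI simp: pullback_closed pullback_image closed smult)
qed

lemma pullback_locally_nilpotent:
  assumes "locally_nilpotent S D"
  shows "locally_nilpotent R (pullback D)"
  unfolding locally_nilpotent_def
proof
  fix x assume x: "x \<in> carrier R"
  have *: "(pullback D ^^ n) x \<in> carrier R \<and> \<phi> ((pullback D ^^ n) x) = (D ^^ n) (\<phi> x)" for n
    using x by (induction n) (auto simp: pullback_closed pullback_image)
  obtain n where "(D ^^ n) (\<phi> x) = \<zero>\<^bsub>S\<^esub>"
    using assms closed[OF x] by (auto simp: locally_nilpotent_def)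
  then have "(pullback D ^^ n) x = \<zero>\<^bsub>R\<^esub>" using * zero by (intro eqI) auto
  then show "\<exists>n. (pullback D ^^ n) x = \<zero>\<^bsub>R\<^esub>" ..
qed

end

end

text \<open>
  If an isomorphism \<open>A[t] \<cong> B[t]\<close> matches the constants on both sides, its restriction to them is an
  isomorphism \<open>A \<cong> B\<close>.
\<close>

lemma poisson_iso_of_constants:
  assumes A: "poisson_algebra K A" and B: "poisson_algebra K B"
    and iso: "\<phi> \<in> poisson_iso K (poisson_poly A) (poisson_poly B)"
    and h: "\<And>a. a \<in> carrier A \<Longrightarrow> \<phi> (monom (UP A) a 0) = monom (UP B) (h a) 0"
    and hc: "\<And>a. a \<in> carrier A \<Longrightarrow> h a \<in> carrier B"
    and onto: "\<And>b. b \<in> carrier B \<Longrightarrow> \<exists>a\<in>carrier A. \<phi> (monom (UP A) a 0) = monom (UP B) b 0"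
  shows "h \<in> poisson_iso K A B"
proof -
  interpret A: poisson_algebra K A by (rule A)
  interpret B: poisson_algebra K B by (rule B)
  interpret UA: UP_cring A "UP A" by (rule A.UP_cring_A)
  interpret UB: UP_cring B "UP B" by (rule B.UP_cring_A)
  interpret \<phi>: poisson_isomorphism K "poisson_poly A" "poisson_poly B" \<phi>
    using A.poisson_poly_algebra B.poisson_poly_algebra iso
    by (simp add: poisson_isomorphism_def poisson_isomorphism_axioms_def)
  have const_eq: "x = y" if "monom (UP B) x 0 = monom (UP B) y 0" "x \<in> carrier B" "y \<in> carrier B" for x y
    using fun_cong[OF that(1), of 0] that(2,3) by (simp add: B.UP_monom)
  have const_eqA: "x = y" if "monom (UP A) x 0 = monom (UP A) y 0" "x \<in> carrier A" "y \<in> carrier A" for x y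
    using fun_cong[OF that(1), of 0] that(2,3) by (simp add: A.UP_monom)
  have m: "monom (UP A) a 0 \<in> carrier (poisson_poly A)" if "a \<in> carrier A" for a
    using that by (simp add: poisson_poly_sel)
  show ?thesis
    unfolding poisson_iso_def
  proof (intro CollectI conjI ballI ring_iso_memI)
    show "h x \<in> carrier B" if "x \<in> carrier A" for x by (rule hc[OF that])
    fix x y assume xy: "x \<in> carrier A" "y \<in> carrier A"
    show "h (x \<otimes>\<^bsub>A\<^esub> y) = h x \<otimes>\<^bsub>B\<^esub> h y"
    proof (rule const_eq)
      have "monom (UP B) (h (x \<otimes>\<^bsub>A\<^esub> y)) 0 = \<phi> (monom (UP A) x 0 \<otimes>\<^bsub>UP A\<^esub> monom (UP A) y 0)"
        using UA.monom_mult[of x y 0 0] xy h[of "x \<otimes>\<^bsub>A\<^esub> y"] by simp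
      also have "\<dots> = monom (UP B) (h x) 0 \<otimes>\<^bsub>UP B\<^esub> monom (UP B) (h y) 0"
        using \<phi>.mult[OF m m, OF xy] xy by (simp add: poisson_poly_sel h)
      also have "\<dots> = monom (UP B) (h x \<otimes>\<^bsub>B\<^esub> h y) 0"
        using UB.monom_mult[of "h x" "h y" 0 0] xy hc by simp
      finally show "monom (UP B) (h (x \<otimes>\<^bsub>A\<^esub> y)) 0 = monom (UP B) (h x \<otimes>\<^bsub>B\<^esub> h y) 0" .
    qed (use xy hc in auto)
    show "h (x \<oplus>\<^bsub>A\<^esub> y) = h x \<oplus>\<^bsub>B\<^esub> h y"
    proof (rule const_eq)
      have "monom (UP B) (h (x \<oplus>\<^bsub>A\<^esub> y)) 0 = \<phi> (monom (UP A) x 0 \<oplus>\<^bsub>UP A\<^esub> monom (UP A) y 0)"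
        using UA.monom_add[of x y 0] xy h[of "x \<oplus>\<^bsub>A\<^esub> y"] by simp
      also have "\<dots> = monom (UP B) (h x) 0 \<oplus>\<^bsub>UP B\<^esub> monom (UP B) (h y) 0"
        using \<phi>.add[OF m m, OF xy] xy by (simp add: poisson_poly_sel h)
      also have "\<dots> = monom (UP B) (h x \<oplus>\<^bsub>B\<^esub> h y) 0"
        using UB.monom_add[of "h x" "h y" 0] xy hc by simp
      finally show "monom (UP B) (h (x \<oplus>\<^bsub>A\<^esub> y)) 0 = monom (UP B) (h x \<oplus>\<^bsub>B\<^esub> h y) 0" .
    qed (use xy hc in auto)
    show "h \<lbrace>x, y\<rbrace>\<^bsub>A\<^esub> = \<lbrace>h x, h y\<rbrace>\<^bsub>B\<^esub>"
      using \<phi>.bracket[OF m m, OF xy] xy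
      by (intro const_eq) (auto simp: A.poly_bracket_const B.poly_bracket_const
          A.bracket_closed B.bracket_closed hc h)
  next
    show "h \<one>\<^bsub>A\<^esub> = \<one>\<^bsub>B\<^esub>"
      using \<phi>.one h[of "\<one>\<^bsub>A\<^esub>"] hc UA.monom_one UB.monom_one
      by (intro const_eq) (auto simp: poisson_poly_sel)
    show "bij_betw h (carrier A) (carrier B)"
      unfolding bij_betw_def
    proof
      show "inj_on h (carrier A)"
      proof (rule inj_onI)
        fix x y assume xy: "x \<in> carrier A" "y \<in> carrier A" "h x = h y"
        then show "x = y" using \<phi>.eqI[OF m m, OF xy(1,2)] h by (intro const_eqA) auto
      qed
      have "b \<in> h ` carrier A" if "b \<in> carrier B" for b
        using onto[OF that] that h hc const_eq by (metis imageI)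
      then show "h ` carrier A = carrier B" using hc by auto
    qed
    fix c x assume cx: "c \<in> carrier K" "x \<in> carrier A"
    have "monom (UP A) (c \<odot>\<^bsub>A\<^esub> x) 0 = c \<odot>\<^bsub>poisson_poly A\<^esub> monom (UP A) x 0"
      using cx by (auto simp: poisson_poly_sel A.UP_monom)
    moreover have "monom (UP B) (c \<odot>\<^bsub>B\<^esub> h x) 0 = c \<odot>\<^bsub>poisson_poly B\<^esub> monom (UP B) (h x) 0"
      using cx hc by (auto simp: poisson_poly_sel B.UP_monom)
    ultimately have "monom (UP B) (h (c \<odot>\<^bsub>A\<^esub> x)) 0 = monom (UP B) (c \<odot>\<^bsub>B\<^esub> h x) 0"
      using \<phi>.smult[OF cx(1) m[OF cx(2)]] cx by (simp flip: h)
    then show "h (c \<odot>\<^bsub>A\<^esub> x) = c \<odot>\<^bsub>B\<^esub> h x" using cx hc by (intro const_eq) auto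
  qed
qed

section \<open>Cancellation\<close>

theorem theorem1p5:
  fixes K :: "('k, 'l) ring_scheme" and A :: "('k, 'a, 'm) poisson_ring_scheme"
  assumes "field K" and "char_zero K"
    and "affine_poisson_domain K A" and "krull_dim A < \<infinity>"
    and "\<not> (\<exists>d. poisson_derivation K A d \<and> locally_nilpotent A d \<and> nontrivial_map A d)"
  shows "poisson_cancellative TYPE('b) K A"
  unfolding poisson_cancellative_def
proof (intro allI impI)
  fix B :: "('k, 'b) poisson_ring"
  assume B: "poisson_algebra K B"
  assume "poisson_isomorphic K (poisson_poly A) (poisson_poly B)"
  then obtain \<phi> where iso: "\<phi> \<in> poisson_iso K (poisson_poly A) (poisson_poly B)"
    by (auto simp: poisson_isomorphic_def)
  have A: "poisson_algebra K A" and fg: "finitely_generated_algebra K A" and dom: "domain A"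
    using assms(3) by (auto simp: affine_poisson_domain_def)
  interpret A: poisson_algebra K A by (rule A)
  interpret B: poisson_algebra K B by (rule B)
  interpret dom: "domain" A by (rule dom)
  interpret \<phi>: poisson_isomorphism K "poisson_poly A" "poisson_poly B" \<phi>
    using A.poisson_poly_algebra B.poisson_poly_algebra iso
    by (simp add: poisson_isomorphism_def poisson_isomorphism_axioms_def)
  have carA: "carrier (poisson_poly A) = up A" and carB: "carrier (poisson_poly B) = up B"
    by (simp_all add: poisson_poly_sel A.UP_carrier B.UP_carrier)
  \<comment> \<open>\<open>D\<close> is \<open>d/dt\<close> of \<open>B[t]\<close> carried over to \<open>A[t]\<close>; its kernel is the preimage of \<open>B\<close>.\<close>
  define D where "D = \<phi>.pullback (formal_deriv B)"
  note fdB = B.formal_deriv_poisson_derivation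
  have pd: "poisson_derivation K (poisson_poly A) D"
    unfolding D_def by (rule \<phi>.pullback_poisson_derivation[OF fdB])
  then have der: "derivation K (poisson_poly A) D" by (simp add: poisson_derivation_def)
  have nil: "locally_nilpotent (poisson_poly A) D"
    unfolding D_def by (rule \<phi>.pullback_locally_nilpotent[OF fdB B.formal_deriv_locally_nilpotent])
  have image: "\<phi> (D p) = formal_deriv B (\<phi> p)" if "p \<in> up A" for p
    unfolding D_def using that carA by (intro \<phi>.pullback_image[OF fdB]) simp
  have const: "D (monom (UP A) a 0) = \<zero>\<^bsub>UP A\<^esub>" if "a \<in> carrier A" for a
    by (rule A.rigid_imp_constants_in_kernel[OF der assms(1,2) dom fg pd nil assms(5) that])
  have preimage: "\<exists>p\<in>up A. \<phi> p = q" if "q \<in> up B" for q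
  proof -
    have "q \<in> \<phi> ` up A" using \<phi>.bij that unfolding carA carB bij_betw_def by simp
    then show ?thesis by blast
  qed
  have zero: "\<phi> \<zero>\<^bsub>UP A\<^esub> = \<zero>\<^bsub>UP B\<^esub>" using \<phi>.zero by (simp add: poisson_poly_sel)
  have zeroA: "\<zero>\<^bsub>UP A\<^esub> \<in> up A" using \<phi>.R.M.zero_closed by (simp add: poisson_poly_sel A.UP_carrier)
  \<comment> \<open>The preimage of the variable of \<open>B[t]\<close> shows that \<open>D\<close> does not vanish.\<close>
  obtain s where s: "s \<in> up A" "\<phi> s = monom (UP B) \<one>\<^bsub>B\<^esub> 1"
    using preimage[OF B.UP_monom_closed[OF B.one_closed]] by blast
  have Ds: "D s \<noteq> \<zero>\<^bsub>UP A\<^esub>"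
  proof
    assume "D s = \<zero>\<^bsub>UP A\<^esub>"
    then have "\<phi> \<one>\<^bsub>poisson_poly A\<^esub> = \<phi> \<zero>\<^bsub>poisson_poly A\<^esub>"
      using image[OF s(1)] s(2) B.formal_deriv_var \<phi>.one \<phi>.zero by (simp add: poisson_poly_sel)
    then have "\<one>\<^bsub>UP A\<^esub> = \<zero>\<^bsub>UP A\<^esub>"
      using \<phi>.eqI[OF \<phi>.R.one_closed \<phi>.R.M.zero_closed] by (simp add: poisson_poly_sel)
    then have "\<one>\<^bsub>UP A\<^esub> 0 = \<zero>\<^bsub>UP A\<^esub> 0" by simp
    then show False by (simp add: UP_def)
  qed
  have kernel: "p = monom (UP A) (p 0) 0" if "p \<in> up A" "D p = \<zero>\<^bsub>UP A\<^esub>" for p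
    using assms(1,2) dom der const s(1) Ds that by (rule A.kernel_eq_constants)
  define h where "h a = \<phi> (monom (UP A) a 0) 0" for a
  have \<phi>c: "\<phi> (monom (UP A) a 0) \<in> up B" if "a \<in> carrier A" for a
    using \<phi>.closed A.UP_monom_closed[OF that] unfolding carA carB .
  have "h \<in> poisson_iso K A B"
  proof (rule poisson_iso_of_constants[OF A B iso])
    fix a assume a: "a \<in> carrier A"
    have "formal_deriv B (\<phi> (monom (UP A) a 0)) = \<zero>\<^bsub>UP B\<^esub>"
      using image[OF A.UP_monom_closed[OF a], of 0] const[OF a] zero by simp
    then show "\<phi> (monom (UP A) a 0) = monom (UP B) (h a) 0"
      unfolding h_def by (rule B.formal_deriv_eq_zero_imp_const[OF assms(1,2) \<phi>c[OF a]])
    show "h a \<in> carrier B" using \<phi>c[OF a] by (auto simp: h_def)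
  next
    fix b assume b: "b \<in> carrier B"
    then obtain p where p: "p \<in> up A" "\<phi> p = monom (UP B) b 0"
      using preimage B.UP_monom_closed by blast
    have "D p \<in> carrier (poisson_poly A)"
      using der p(1) unfolding derivation_def carA by auto
    then have "D p = \<zero>\<^bsub>UP A\<^esub>"
      using zeroA image[OF p(1)] p(2) B.formal_deriv_monom_0[OF b] zero carA
      by (intro \<phi>.eqI) auto
    then have "p = monom (UP A) (p 0) 0" by (rule kernel[OF p(1)])
    then show "\<exists>a\<in>carrier A. \<phi> (monom (UP A) a 0) = monom (UP B) b 0" using p by (metis mem_upD)
  qed
  then show "poisson_isomorphic K A B" by (auto simp: poisson_isomorphic_def)
qed

end
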